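(* Let $p$ be a prime and $k$ a field of characteristic $p$. Suppose a finite group $G$ contains an elementary abelian subgroup $E = \langle g_1, g_2 \rangle \simeq (\mathbb{Z}/p\mathbb{Z})^2$ of rank $2$. Then $\operatorname{ed}(\mathbf{Rep}_{G,k}) = \infty$.
   Context: $\mathbf{Rep}_{G,k}$ is the covariant functor from field extensions of $k$ to sets, sending $K/k$ to the set of $K$-isomorphism classes of representations $G\to\mathrm{GL}_n(K)$, with $n\ge1$ allowed to vary. For a representation $\rho\colon G\to \mathrm{GL}_n(K)$, $\operatorname{ed}(\rho)$ is the smallest transcendence degree over $k$ of an intermediate field $k\subset K_0\subset K$ such that $\rho$ is $K$-equivalent to a representation $G\to\mathrm{GL}_n(K_0)$. $\operatorname{ed}(\mathbf{Rep}_{G,k})$ is the supremum of $\operatorname{ed}(\rho)$ over all field extensions $K/k$ and all representations $\rho$ of $G$ over $K$. *)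

theory Defs
  imports
    "HOL-Algebra.Elementary_Groups"
    "HOL-Algebra.Generated_Groups"
    "HOL-Algebra.Subrings"
    "HOL-Library.Multiset"
    "HOL-Library.Extended_Nat"
    "HOL-Library.Equipollence"
    "HOL-Computational_Algebra.Primes"
    "Jordan_Normal_Form.Matrix"
begin

text \<open>Fields are explicit-carrier structures throughout, because the supremum defining the
  essential dimension ranges over all extension fields of \<open>k\<close>.\<close>

definition has_characteristic :: "('a, 'm) ring_scheme \<Rightarrow> nat \<Rightarrow> bool" where
  "has_characteristic R p \<longleftrightarrow> (\<forall>n::nat. [n] \<cdot>\<^bsub>R\<^esub> \<one>\<^bsub>R\<^esub> = \<zero>\<^bsub>R\<^esub> \<longleftrightarrow> p dvd n)"

definition field_extension ::
  "('a, 'm) ring_scheme \<Rightarrow> ('b, 'n) ring_scheme \<Rightarrow> ('a \<Rightarrow> 'b) \<Rightarrow> bool" where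
  "field_extension k K \<iota> \<longleftrightarrow> field k \<and> field K \<and> \<iota> \<in> Ring.ring_hom k K"

text \<open>The arithmetic on the type of matrices provided by the library is that of a type class, so
  the type only serves as a container here; the operations come from the ring \<open>R\<close>.\<close>

definition square_matrices :: "nat \<Rightarrow> ('a, 'm) ring_scheme \<Rightarrow> 'a mat monoid" where
  "square_matrices n R =
    \<lparr> carrier = {A \<in> carrier_mat n n. elements_mat A \<subseteq> carrier R},
      monoid.mult = (\<lambda>A B. mat n n (\<lambda>(i, j). \<Oplus>\<^bsub>R\<^esub>l\<in>{..<n}. A $$ (i, l) \<otimes>\<^bsub>R\<^esub> B $$ (l, j))),
      one = mat n n (\<lambda>(i, j). if i = j then \<one>\<^bsub>R\<^esub> else \<zero>\<^bsub>R\<^esub>) \<rparr>"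

definition GL :: "nat \<Rightarrow> ('a, 'm) ring_scheme \<Rightarrow> 'a mat monoid" where
  "GL n R = units_of (square_matrices n R)"

definition equivalent_reps ::
  "('b, 'n) ring_scheme \<Rightarrow> nat \<Rightarrow> ('g, 'm) monoid_scheme \<Rightarrow> ('g \<Rightarrow> 'b mat) \<Rightarrow> ('g \<Rightarrow> 'b mat) \<Rightarrow> bool"
  where
  "equivalent_reps K n G \<rho> \<sigma> \<longleftrightarrow>
    (\<exists>P \<in> carrier (GL n K). \<forall>g \<in> carrier G.
      \<sigma> g = P \<otimes>\<^bsub>GL n K\<^esub> \<rho> g \<otimes>\<^bsub>GL n K\<^esub> inv\<^bsub>GL n K\<^esub> P)"

text \<open>A multiset \<open>m\<close> of elements of \<open>K\<close> encodes the monomial in which \<open>s\<close> has exponent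
  \<open>count m s\<close>. A finite set \<open>M\<close> of monomials with coefficients \<open>c\<close> is a polynomial
  over \<open>F\<close> in the variables \<open>S\<close>, evaluated at the elements of \<open>S\<close> themselves.\<close>

definition monomial_value :: "('b, 'n) ring_scheme \<Rightarrow> 'b multiset \<Rightarrow> 'b" where
  "monomial_value K m = (\<Otimes>\<^bsub>K\<^esub>s\<in>set_mset m. s [^]\<^bsub>K\<^esub> count m s)"

definition algebraically_independent ::
  "('b, 'n) ring_scheme \<Rightarrow> 'b set \<Rightarrow> 'b set \<Rightarrow> bool" where
  "algebraically_independent K F S \<longleftrightarrow>
    S \<subseteq> carrier K \<and>
    (\<forall>M c. finite M \<longrightarrow> (\<forall>m\<in>M. set_mset m \<subseteq> S) \<longrightarrow> c \<in> M \<rightarrow> F \<longrightarrow>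
      (\<Oplus>\<^bsub>K\<^esub>m\<in>M. c m \<otimes>\<^bsub>K\<^esub> monomial_value K m) = \<zero>\<^bsub>K\<^esub> \<longrightarrow>
      (\<forall>m\<in>M. c m = \<zero>\<^bsub>K\<^esub>))"

text \<open>Transcendence degree over \<open>F\<close> of a subfield \<open>L\<close> of \<open>K\<close>. Every infinite transcendence degree
  becomes \<open>\<infinity>\<close>.\<close>

definition trdeg :: "('b, 'n) ring_scheme \<Rightarrow> 'b set \<Rightarrow> 'b set \<Rightarrow> enat" where
  "trdeg K F L =
    Sup {enat (card S) | S. finite S \<and> S \<subseteq> L \<and> algebraically_independent K F S}"

text \<open>Here \<open>F\<close> is the copy of the base field inside \<open>K\<close>. Infima in \<^typ>\<open>enat\<close> of nonempty sets
  are attained, and \<open>K\<^sub>0 = carrier K\<close> is always admissible when \<open>\<rho>\<close> is a representation.\<close>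

definition ed_rep ::
  "('b, 'n) ring_scheme \<Rightarrow> 'b set \<Rightarrow> nat \<Rightarrow> ('g, 'm) monoid_scheme \<Rightarrow> ('g \<Rightarrow> 'b mat) \<Rightarrow> enat" where
  "ed_rep K F n G \<rho> =
    Inf {trdeg K F K\<^sub>0 | K\<^sub>0. subfield K\<^sub>0 K \<and> F \<subseteq> K\<^sub>0 \<and>
      (\<exists>\<sigma> \<in> hom G (GL n (K\<lparr>carrier := K\<^sub>0\<rparr>)). equivalent_reps K n G \<rho> \<sigma>)}"

text \<open>HOL cannot quantify over types, so the extension fields range over those whose elements live
  in a given type \<open>'b\<close>, which plays the role of a universe. For a finite group \<open>G\<close> the value does
  not depend on \<open>'b\<close> as soon as \<open>'b\<close> is infinite and has at least as many elements as \<open>k\<close>: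
  a representation descends to a subfield \<open>K\<^sub>0\<close> attaining \<open>ed_rep\<close>; this has finite transcendence
  degree over \<open>k\<close>, hence has a copy in \<open>'b\<close>, and the descended representation has the same
  essential dimension over \<open>K\<^sub>0\<close>.\<close>

definition ed_Rep ::
  "'b itself \<Rightarrow> ('g, 'm) monoid_scheme \<Rightarrow> ('a, 'n) ring_scheme \<Rightarrow> enat" where
  "ed_Rep U G k =
    Sup {ed_rep K (\<iota> ` carrier k) n G \<rho> | (K :: 'b ring) \<iota> n \<rho>.
      field_extension k K \<iota> \<and> n \<ge> 1 \<and> \<rho> \<in> hom G (GL n K)}"

end

theory Submission
  imports Defs "HOL-Algebra.Finite_Extensions" "HOL-Algebra.Generated_Fields"
begin

text \<open>A module over \<open>E = \<langle>h1, h2\<rangle> \<simeq> (\<int>/p)\<^sup>2\<close> in characteristic \<open>p\<close> can carry arbitrarily many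
continuous parameters, and these parameters are visible to every field of definition. For \<open>x\<close> in
an extension field \<open>K\<close> let \<open>V\<^sub>x\<close> be the two-dimensional module on which \<open>h1 - 1\<close> acts as
\<open>e\<^sub>2 \<mapsto> e\<^sub>1 \<mapsto> 0\<close> and \<open>h2 - 1\<close> as \<open>x\<close> times that nilpotent map. Take \<open>K\<close> to be a function field over
\<open>k\<close> in independent variables \<open>a\<^sub>0, \<dots>, a\<^sub>d\<^sub>-\<^sub>1\<close>, and let \<open>\<rho>\<close> be the representation of \<open>G\<close> induced
from \<open>\<Oplus>\<^sub>i V\<^bsub>a\<^sub>i\<^esub>\<close>. The claim is that \<open>ed \<rho> \<ge> d\<close>.

Suppose that \<open>\<rho>\<close> is equivalent to a representation \<open>\<sigma>\<close> over \<open>K\<^sub>0\<close>, and put \<open>X\<^sub>1 = \<sigma>(h1) - 1\<close>,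
\<open>X\<^sub>2 = \<sigma>(h2) - 1\<close>, matrices over \<open>K\<^sub>0\<close>. As \<open>V\<^sub>x\<close> is a direct summand of the restriction of \<open>\<rho>\<close> to
\<open>E\<close> for each \<open>x = a\<^sub>i\<close>, the pencil \<open>t X\<^sub>1 - X\<^sub>2\<close> drops rank at \<open>t = x\<close>, which forces \<open>x\<close> to be
algebraic over \<open>K\<^sub>0\<close>. Null vectors serve to prove this (\<open>pencil_root_algebraic\<close>): the summand
supplies a right null vector \<open>u\<close> and a left null vector \<open>l\<close> of \<open>x X\<^sub>1 - X\<^sub>2\<close> with
\<open>l X\<^sub>1 u \<noteq> 0\<close>. If \<open>x\<close> were transcendental over \<open>K\<^sub>0\<close>, then \<open>u\<close> could be replaced by a null vector
\<open>\<Sum>\<^sub>s x\<^sup>s v\<^sub>s\<close> with all \<open>v\<^sub>s\<close> over \<open>K\<^sub>0\<close>, and comparing coefficients gives \<open>X\<^sub>2 v\<^sub>0 = 0\<close> and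
\<open>X\<^sub>1 v\<^sub>s = X\<^sub>2 v\<^sub>s\<^sub>+\<^sub>1\<close>; as \<open>l X\<^sub>2 = x l X\<^sub>1\<close> with \<open>x \<noteq> 0\<close>, this makes all \<open>l X\<^sub>1 v\<^sub>s\<close> vanish
one after the other.

So the \<open>d\<close> independent elements \<open>a\<^sub>i\<close> are algebraic over \<open>K\<^sub>0\<close>. Being algebraic over a set
is a closure operator with the exchange property, and Steinitz exchange then yields \<open>d\<close> independent
elements inside \<open>K\<^sub>0\<close> itself (\<open>trdeg_ge\<close>).

The remaining ingredient is the existence of \<open>K\<close> in the prescribed type: iterating the passage from a
field to the fraction field of its polynomial ring, each time realised on a subset of the infinite
type by a cardinality argument (\<open>ex_extension_with_independent_elements\<close>).\<close>

(* In what follows, prime is primality of natural numbers, not primality in a ring given by its carrier. *)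
hide_const (open) Divisibility.prime

section \<open>Finite sums in rings\<close>

lemma (in abelian_monoid) finsum_swap:
  assumes "finite A" "finite B" "\<And>x y. x \<in> A \<Longrightarrow> y \<in> B \<Longrightarrow> f x y \<in> carrier G"
  shows "(\<Oplus>x\<in>A. \<Oplus>y\<in>B. f x y) = (\<Oplus>y\<in>B. \<Oplus>x\<in>A. f x y)"
  using assms(1,3)
proof (induction A rule: finite_induct)
  case empty
  then show ?case by simp
next
  case (insert a A)
  have "(\<Oplus>x\<in>insert a A. \<Oplus>y\<in>B. f x y) = (\<Oplus>y\<in>B. f a y) \<oplus> (\<Oplus>y\<in>B. \<Oplus>x\<in>A. f x y)"
    using insert by (subst finsum_insert) (auto intro!: finsum_closed)
  also have "\<dots> = (\<Oplus>y\<in>B. f a y \<oplus> (\<Oplus>x\<in>A. f x y))"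
    using insert by (subst finsum_addf) (auto intro!: finsum_closed)
  also have "\<dots> = (\<Oplus>y\<in>B. \<Oplus>x\<in>insert a A. f x y)"
    using insert by (intro finsum_cong' refl) (auto simp: finsum_insert Pi_def intro!: finsum_closed)
  finally show ?case .
qed

lemma (in ring) finsum_in_subring:
  assumes "subring S R" "f \<in> A \<rightarrow> S"
  shows "(\<Oplus>i\<in>A. f i) \<in> S"
  using assms(2)
proof (induction A rule: infinite_finite_induct)
  case (insert a A)
  then have "f \<in> A \<rightarrow> carrier R" "f a \<in> carrier R" using subringE(1)[OF assms(1)] by auto
  then show ?case using insert subringE(7)[OF assms(1)] by auto
qed (use subringE(2)[OF assms(1)] in auto)

text \<open>Associativity of the product of a row vector, a matrix and a column vector. This form covers both
matrix multiplication and the substitution of one linear combination into another.\<close>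

lemma (in ring) finsum_mult_assoc:
  assumes "finite A" "finite B"
    and "\<And>j. j \<in> A \<Longrightarrow> a j \<in> carrier R" "\<And>j l. j \<in> A \<Longrightarrow> l \<in> B \<Longrightarrow> c j l \<in> carrier R"
    and "\<And>l. l \<in> B \<Longrightarrow> b l \<in> carrier R"
  shows "(\<Oplus>j\<in>A. a j \<otimes> (\<Oplus>l\<in>B. c j l \<otimes> b l)) = (\<Oplus>l\<in>B. (\<Oplus>j\<in>A. a j \<otimes> c j l) \<otimes> b l)"
proof -
  have "(\<Oplus>j\<in>A. a j \<otimes> (\<Oplus>l\<in>B. c j l \<otimes> b l)) = (\<Oplus>j\<in>A. \<Oplus>l\<in>B. a j \<otimes> c j l \<otimes> b l)"
  proof (intro finsum_cong' refl)
    fix j assume j: "j \<in> A"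
    have "a j \<otimes> (\<Oplus>l\<in>B. c j l \<otimes> b l) = (\<Oplus>l\<in>B. a j \<otimes> (c j l \<otimes> b l))"
      using assms j by (intro finsum_rdistr) auto
    also have "\<dots> = (\<Oplus>l\<in>B. a j \<otimes> c j l \<otimes> b l)"
      using assms j by (intro finsum_cong') (auto simp: m_assoc)
    finally show "a j \<otimes> (\<Oplus>l\<in>B. c j l \<otimes> b l) = (\<Oplus>l\<in>B. a j \<otimes> c j l \<otimes> b l)" .
  qed (use assms in \<open>auto intro!: finsum_closed\<close>)
  also have "\<dots> = (\<Oplus>l\<in>B. \<Oplus>j\<in>A. a j \<otimes> c j l \<otimes> b l)"
    using assms by (intro finsum_swap) auto
  also have "\<dots> = (\<Oplus>l\<in>B. (\<Oplus>j\<in>A. a j \<otimes> c j l) \<otimes> b l)"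
    using assms by (intro finsum_cong' refl finsum_ldistr[symmetric]) (auto intro!: finsum_closed)
  finally show ?thesis .
qed

lemma (in abelian_monoid) finsum_two:
  assumes "finite A" "p \<in> A" "q \<in> A" "p \<noteq> q" "f p \<in> carrier G" "f q \<in> carrier G"
    and "\<And>x. x \<in> A \<Longrightarrow> x \<noteq> p \<Longrightarrow> x \<noteq> q \<Longrightarrow> f x = \<zero>"
  shows "(\<Oplus>x\<in>A. f x) = f p \<oplus> f q"
proof -
  have car: "f x \<in> carrier G" if "x \<in> A" for x
    using assms(5-7) that by (cases "x = p"; cases "x = q") auto
  have "(\<Oplus>x\<in>A. f x) = (\<Oplus>x\<in>{p, q}. f x)"
    using assms car by (intro add.finprod_mono_neutral_cong_right) auto
  then show ?thesis using assms by simp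
qed

section \<open>Algebraic elements as roots of power sums, and exchange\<close>

text \<open>An index range longer than the coefficient list lets polynomials of different degrees share one range.\<close>

lemma (in ring) eval_as_finsum:
  assumes "set p \<subseteq> carrier R" "x \<in> carrier R" "length p \<le> n"
  shows "eval p x = (\<Oplus>i\<in>{..<n}. coeff p i \<otimes> x [^] i)"
  using assms(1,3)
proof (induction p)
  case Nil
  have "(\<Oplus>i\<in>{..<n}. \<zero> \<otimes> x [^] i) = (\<Oplus>i\<in>{..<n}. \<zero>)"
    using assms(2) by (intro finsum_cong') auto
  then show ?case by simp
next
  case (Cons a p)
  have a: "a \<in> carrier R" and p: "set p \<subseteq> carrier R" "length p < n" using Cons.prems by auto
  have c: "coeff p i \<in> carrier R" for i using p by simp
  have "(\<Oplus>i\<in>{..<n}. coeff (a # p) i \<otimes> x [^] i)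
      = (\<Oplus>i\<in>{..<n}. (if length p = i then a \<otimes> x [^] i else \<zero>) \<oplus> coeff p i \<otimes> x [^] i)"
    using a c assms(2) coeff_length[of p] by (intro finsum_cong') auto
  also have "\<dots> = (\<Oplus>i\<in>{..<n}. (if length p = i then a \<otimes> x [^] i else \<zero>))
      \<oplus> (\<Oplus>i\<in>{..<n}. coeff p i \<otimes> x [^] i)"
    using a c assms(2) by (intro finsum_addf) auto
  also have "(\<Oplus>i\<in>{..<n}. (if length p = i then a \<otimes> x [^] i else \<zero>)) = a \<otimes> x [^] length p"
    using a p assms(2) by (subst finsum_singleton) auto
  finally show ?case using Cons by simp
qed

lemma (in ring) coeff_in_subset:
  assumes "set p \<subseteq> L" "\<zero> \<in> L"
  shows "coeff p i \<in> L"
  using assms by (induction p) auto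

lemma (in ring) coeff_map_rev_upt:
  "coeff (map f (rev [0..<n])) i = (if i < n then f i else \<zero>)"
  by (induction n) auto

lemma (in domain) algebraic_of_power_sum:
  fixes n :: nat
  assumes "subring L R" "x \<in> carrier R" "f \<in> {..<n} \<rightarrow> L"
    and "(\<Oplus>i\<in>{..<n}. f i \<otimes> x [^] i) = \<zero>" "j < n" "f j \<noteq> \<zero>"
  shows "(algebraic over L) x"
proof -
  let ?p = "map f (rev [0..<n])"
  note L = subringE(1)[OF assms(1)]
  have set: "set ?p \<subseteq> L" using assms(3) by auto
  have "(\<Oplus>i\<in>{..<n}. coeff ?p i \<otimes> x [^] i) = (\<Oplus>i\<in>{..<n}. f i \<otimes> x [^] i)"
    using assms(2,3) L by (intro finsum_cong') (auto simp: coeff_map_rev_upt)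
  then have "eval ?p x = \<zero>"
    using eval_as_finsum[of ?p x n] set L assms(2,4) by auto
  then have "eval (normalize ?p) x = \<zero>" using eval_normalize[of ?p x] set L assms(2) by auto
  moreover have "normalize ?p \<noteq> []"
  proof
    assume "normalize ?p = []"
    then have "coeff ?p j = \<zero>" using normalize_coeff[of ?p] by simp
    then show False using assms(5,6) by (simp add: coeff_map_rev_upt)
  qed
  moreover have "normalize ?p \<in> carrier (L[X])"
    using normalize_gives_polynomial[OF set] by (simp add: univ_poly_carrier)
  ultimately show ?thesis by (intro algebraicI)
qed

lemma (in domain) power_sum_of_algebraic:
  assumes "subring L R" "x \<in> carrier R" "(algebraic over L) x"
  obtains n :: nat and f j where "f \<in> {..<n} \<rightarrow> L" "(\<Oplus>i\<in>{..<n}. f i \<otimes> x [^] i) = \<zero>" "j < n" "f j \<noteq> \<zero>"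
proof -
  obtain p where p: "p \<in> carrier (L[X])" "p \<noteq> []" "eval p x = \<zero>"
    using algebraicE[OF assms] .
  then have pol: "set p \<subseteq> L" "lead_coeff p \<noteq> \<zero>"
    by (auto simp: univ_poly_carrier[symmetric] polynomial_def)
  show thesis
  proof (rule that)
    show "coeff p \<in> {..<length p} \<rightarrow> L"
      using coeff_in_subset pol subringE(2)[OF assms(1)] by auto
    show "(\<Oplus>i\<in>{..<length p}. coeff p i \<otimes> x [^] i) = \<zero>"
      using eval_as_finsum[of p x "length p"] p pol subringE(1)[OF assms(1)] assms(2) by auto
    show "degree p < length p" "coeff p (degree p) \<noteq> \<zero>" using p pol by (cases p; auto)+
  qed
qed

text \<open>A common degree bound makes the coefficients of several elements of \<open>L[x]\<close> a rectangular array, so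
that the order of summation over the elements and over the powers of \<open>x\<close> can be interchanged.\<close>

lemma (in domain) simple_extension_as_power_sums:
  assumes "subring L R" "x \<in> carrier R" "finite I" "\<And>i. i \<in> I \<Longrightarrow> g i \<in> simple_extension L x"
  shows "\<exists>(n::nat) f. \<forall>i\<in>I. (\<forall>s. f i s \<in> L) \<and> g i = (\<Oplus>s\<in>{..<n}. f i s \<otimes> x [^] s)"
proof -
  note L = subringE(1,2)[OF assms(1)]
  have "\<exists>p. set p \<subseteq> L \<and> eval p x = g i" if "i \<in> I" for i
    using assms(4)[OF that] simple_extension_as_eval_img[OF L(1) assms(2)]
    by (force simp: univ_poly_carrier[symmetric] polynomial_def)
  then obtain p where p: "\<And>i. i \<in> I \<Longrightarrow> set (p i) \<subseteq> L \<and> eval (p i) x = g i" by metis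
  define n where "n = (\<Sum>i\<in>I. length (p i))"
  have n: "length (p i) \<le> n" if "i \<in> I" for i
    unfolding n_def using that assms(3) by (intro member_le_sum) auto
  have "coeff (p i) s \<in> L" if "i \<in> I" for i s
    using p[OF that] L coeff_in_subset by auto
  moreover have "g i = (\<Oplus>s\<in>{..<n}. coeff (p i) s \<otimes> x [^] s)" if "i \<in> I" for i
    using eval_as_finsum[of "p i" x n] p[OF that] n[OF that] L assms(2) by auto
  ultimately show ?thesis by (intro exI[of _ n] exI[of _ "\<lambda>i. coeff (p i)"]) blast
qed

text \<open>The field generated by a subring is its field of fractions inside the ambient field. In the form
\<open>b \<otimes> h \<in> S\<close> a fraction is ready for clearing denominators.\<close>

lemma (in field) generate_field_of_subring_fraction:
  assumes "subring S R" "h \<in> generate_field R S"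
  shows "\<exists>b\<in>S. b \<noteq> \<zero> \<and> b \<otimes> h \<in> S"
  using assms(2)
proof (induction rule: generate_field.induct)
  note S = subringE[OF assms(1)]
  note car = generate_field_in_carrier[OF S(1)]
  { case one
    then show ?case using S by (intro bexI[of _ \<one>]) auto }
  { case (incl h)
    then show ?case using S by (intro bexI[of _ \<one>]) auto }
  { case (a_inv h)
    then obtain b where b: "b \<in> S" "b \<noteq> \<zero>" "b \<otimes> h \<in> S" by blast
    moreover have "b \<otimes> (\<ominus> h) = \<ominus> (b \<otimes> h)" using b S a_inv car by (simp add: r_minus subsetD)
    ultimately show ?case using S by metis }
  { case (m_inv h)
    then obtain b where b: "b \<in> S" "b \<noteq> \<zero>" "b \<otimes> h \<in> S" by blast
    have h: "h \<in> carrier R" "b \<in> carrier R" using car m_inv b S by auto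
    have "b \<otimes> h \<noteq> \<zero>" using h b m_inv integral_iff by auto
    moreover have "b \<otimes> h \<otimes> inv h = b"
      using h m_inv by (simp add: m_assoc field_Units)
    ultimately show ?case using b by metis }
  { case (eng_add h1 h2)
    then obtain b c where b: "b \<in> S" "b \<noteq> \<zero>" "b \<otimes> h1 \<in> S" and c: "c \<in> S" "c \<noteq> \<zero>" "c \<otimes> h2 \<in> S"
      by blast
    have h: "h1 \<in> carrier R" "h2 \<in> carrier R" "b \<in> carrier R" "c \<in> carrier R"
      using car eng_add b c S by auto
    have "b \<otimes> c \<otimes> (h1 \<oplus> h2) = c \<otimes> (b \<otimes> h1) \<oplus> b \<otimes> (c \<otimes> h2)"
      using h by algebra
    moreover have "b \<otimes> c \<noteq> \<zero>" using h b c integral_iff by auto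
    ultimately show ?case using b c S by (intro bexI[of _ "b \<otimes> c"]) auto }
  { case (eng_mult h1 h2)
    then obtain b c where b: "b \<in> S" "b \<noteq> \<zero>" "b \<otimes> h1 \<in> S" and c: "c \<in> S" "c \<noteq> \<zero>" "c \<otimes> h2 \<in> S"
      by blast
    have h: "h1 \<in> carrier R" "h2 \<in> carrier R" "b \<in> carrier R" "c \<in> carrier R"
      using car eng_mult b c S by auto
    have "b \<otimes> c \<otimes> (h1 \<otimes> h2) = (b \<otimes> h1) \<otimes> (c \<otimes> h2)"
      using h by algebra
    moreover have "b \<otimes> c \<noteq> \<zero>" using h b c integral_iff by auto
    ultimately show ?case using b c S by (intro bexI[of _ "b \<otimes> c"]) auto }
qed

lemma (in field) common_denominator:
  fixes n :: nat
  assumes "subring S R" "f \<in> {..<n} \<rightarrow> generate_field R S"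
  shows "\<exists>b\<in>S. b \<noteq> \<zero> \<and> (\<forall>i<n. b \<otimes> f i \<in> S)"
  using assms(2)
proof (induction n)
  case 0
  then show ?case using subringE(3)[OF assms(1)] by (intro bexI[of _ \<one>]) auto
next
  case (Suc n)
  note S = subringE[OF assms(1)]
  have "f \<in> {..<n} \<rightarrow> generate_field R S" using Suc.prems by (auto simp: Pi_iff)
  then obtain b where b: "b \<in> S" "b \<noteq> \<zero>" "\<forall>i<n. b \<otimes> f i \<in> S" using Suc.IH by blast
  obtain c where c: "c \<in> S" "c \<noteq> \<zero>" "c \<otimes> f n \<in> S"
    using generate_field_of_subring_fraction[OF assms(1), of "f n"] Suc.prems by auto
  have f: "f i \<in> carrier R" if "i < Suc n" for i
    using that Suc.prems generate_field_in_carrier[OF S(1)] by auto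
  have bc: "b \<in> carrier R" "c \<in> carrier R" using b c S by auto
  have "b \<otimes> c \<otimes> f i \<in> S" if "i < Suc n" for i
  proof (cases "i = n")
    case True
    have "b \<otimes> c \<otimes> f i = b \<otimes> (c \<otimes> f n)" using bc f[OF that] True by (simp add: m_assoc)
    then show ?thesis using b c S by auto
  next
    case False
    have "b \<otimes> c \<otimes> f i = c \<otimes> (b \<otimes> f i)" using bc f[OF that] by algebra
    then show ?thesis using b c S that False by auto
  qed
  moreover have "b \<otimes> c \<noteq> \<zero>" using bc b c integral_iff by auto
  ultimately show ?case using b c S by (intro bexI[of _ "b \<otimes> c"]) auto
qed

lemma (in field) subfield_generate_field [simp]: "subfield L R \<Longrightarrow> generate_field R L = L"
  using generate_fieldI[of L L] subfieldE(3) by auto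

text \<open>If \<open>x\<close> is algebraic over \<open>L(y)\<close>, clearing denominators turns its equation into a polynomial relation
\<open>\<Sum>\<^sub>i\<^sub>,\<^sub>s a\<^sub>i\<^sub>s y\<^sup>s x\<^sup>i = 0\<close> over \<open>L\<close>. Read as a polynomial in \<open>y\<close>, it has coefficients
\<open>\<Sum>\<^sub>i a\<^sub>i\<^sub>s x\<^sup>i\<close> in \<open>L(x)\<close>, and these do not all vanish because \<open>x\<close> is transcendental over \<open>L\<close>.\<close>

lemma (in field) algebraic_exchange:
  assumes L: "subfield L R" and x: "x \<in> carrier R" and y: "y \<in> carrier R"
    and alg: "(algebraic over generate_field R (insert y L)) x"
    and trans: "\<not> (algebraic over L) x"
  shows "(algebraic over generate_field R (insert x L)) y"
proof -
  note Lc = subfieldE(3)[OF L] and Lr = subfieldE(1)[OF L]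
  define S where "S = simple_extension L y"
  have S: "subring S R" unfolding S_def by (rule simple_extension_is_subring[OF Lr y])
  have Sc: "S \<subseteq> carrier R" using subringE(1)[OF S] .
  have "insert y L \<subseteq> S"
    unfolding S_def using simple_extension_incl[OF Lc y] simple_extension_mem[OF Lr y] by auto
  then have sub: "generate_field R (insert y L) \<subseteq> generate_field R S"
    using mono_generate_field[of "insert y L" S] Sc by auto
  have Ly: "subring (generate_field R (insert y L)) R"
    using generate_field_is_subfield[of "insert y L"] Lc y subfieldE(1) by auto
  obtain n :: nat and f i0 where f: "f \<in> {..<n} \<rightarrow> generate_field R (insert y L)"
      and sum0: "(\<Oplus>i\<in>{..<n}. f i \<otimes> x [^] i) = \<zero>" and i0: "i0 < n" "f i0 \<noteq> \<zero>"
    by (rule power_sum_of_algebraic[OF Ly x alg])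
  have fS: "f \<in> {..<n} \<rightarrow> generate_field R S" using f sub by auto
  have fc: "f i \<in> carrier R" if "i < n" for i
    using fS that generate_field_in_carrier[OF Sc] by auto
  obtain b where b: "b \<in> S" "b \<noteq> \<zero>" "\<And>i. i < n \<Longrightarrow> b \<otimes> f i \<in> S"
    using common_denominator[OF S fS] by blast
  have bc: "b \<in> carrier R" using b Sc by auto
  have bS: "b \<otimes> f i \<in> simple_extension L y" if "i \<in> {..<n}" for i
    using b(3) that by (auto simp: S_def)
  have "\<exists>(m::nat) a. \<forall>i\<in>{..<n}. (\<forall>s. a i s \<in> L) \<and> b \<otimes> f i = (\<Oplus>s\<in>{..<m}. a i s \<otimes> y [^] s)"
    by (rule simple_extension_as_power_sums[OF Lr y finite_lessThan bS])
  then obtain m :: nat and a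
    where afull: "\<forall>i\<in>{..<n}. (\<forall>s. a i s \<in> L) \<and> b \<otimes> f i = (\<Oplus>s\<in>{..<m}. a i s \<otimes> y [^] s)"
    by (elim exE)
  have a: "a i s \<in> L" if "i \<in> {..<n}" for i s using afull that by simp
  have af: "b \<otimes> f i = (\<Oplus>s\<in>{..<m}. a i s \<otimes> y [^] s)" if "i \<in> {..<n}" for i
    using afull that by simp
  have ac: "i < n \<Longrightarrow> a i s \<in> carrier R" for i s using a[of i s] Lc by auto
  have "\<exists>s<m. a i0 s \<noteq> \<zero>"
  proof (rule ccontr)
    assume "\<not> ?thesis"
    then have "(\<Oplus>s\<in>{..<m}. a i0 s \<otimes> y [^] s) = (\<Oplus>s\<in>{..<m}. \<zero>)"
      using y by (intro finsum_cong') auto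
    then have "b \<otimes> f i0 = \<zero>" using af[of i0] i0 by simp
    then show False using b bc fc[OF i0(1)] i0 integral_iff by auto
  qed
  then obtain s0 where s0: "s0 < m" "a i0 s0 \<noteq> \<zero>" by blast
  define g where "g = (\<lambda>s. \<Oplus>i\<in>{..<n}. a i s \<otimes> x [^] i)"
  let ?Lx = "generate_field R (insert x L)"
  have Lxf: "subfield ?Lx R" using generate_field_is_subfield[of "insert x L"] Lc x by auto
  note Lx = subringE[OF subfieldE(1)[OF Lxf]]
  have pow: "x [^] (i::nat) \<in> ?Lx" for i
    by (induction i) (use Lx generate_field.incl[of x "insert x L" R] in auto)
  have aLx: "a i s \<in> ?Lx" if "i < n" for i s
    using a[of i s] that by (auto intro: generate_field.incl)
  have gL: "g s \<in> ?Lx" for s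
    unfolding g_def using aLx pow Lx(6) by (intro finsum_in_subring[OF subfieldE(1)[OF Lxf]]) auto
  have "g s0 \<noteq> \<zero>"
    using algebraic_of_power_sum[OF Lr x, of "\<lambda>i. a i s0" n i0] a i0 s0 trans unfolding g_def by auto
  moreover have "(\<Oplus>s\<in>{..<m}. g s \<otimes> y [^] s) = \<zero>"
  proof -
    have "(\<Oplus>s\<in>{..<m}. g s \<otimes> y [^] s) = (\<Oplus>s\<in>{..<m}. \<Oplus>i\<in>{..<n}. a i s \<otimes> y [^] s \<otimes> x [^] i)"
    proof (intro finsum_cong' refl)
      fix s assume "s \<in> {..<m}"
      have "g s \<otimes> y [^] s = (\<Oplus>i\<in>{..<n}. a i s \<otimes> x [^] i \<otimes> y [^] s)"
        unfolding g_def using ac x y by (intro finsum_ldistr) auto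
      also have "\<dots> = (\<Oplus>i\<in>{..<n}. a i s \<otimes> y [^] s \<otimes> x [^] i)"
      proof (intro finsum_cong' refl)
        show "a i s \<otimes> x [^] i \<otimes> y [^] s = a i s \<otimes> y [^] s \<otimes> x [^] i" if "i \<in> {..<n}" for i
          using ac[of i s] that x y by (simp add: m_ac)
      qed (use ac x y in auto)
      finally show "g s \<otimes> y [^] s = (\<Oplus>i\<in>{..<n}. a i s \<otimes> y [^] s \<otimes> x [^] i)" .
    qed (use ac x y in \<open>auto intro!: finsum_closed\<close>)
    also have "\<dots> = (\<Oplus>i\<in>{..<n}. \<Oplus>s\<in>{..<m}. a i s \<otimes> y [^] s \<otimes> x [^] i)"
      using ac x y by (intro finsum_swap) auto
    also have "\<dots> = (\<Oplus>i\<in>{..<n}. b \<otimes> (f i \<otimes> x [^] i))"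
    proof (intro finsum_cong' refl)
      fix i assume i: "i \<in> {..<n}"
      have "(\<Oplus>s\<in>{..<m}. a i s \<otimes> y [^] s \<otimes> x [^] i) = b \<otimes> f i \<otimes> x [^] i"
        unfolding af[OF i] using ac i x y by (intro finsum_ldistr[symmetric]) auto
      then show "(\<Oplus>s\<in>{..<m}. a i s \<otimes> y [^] s \<otimes> x [^] i) = b \<otimes> (f i \<otimes> x [^] i)"
        using bc fc[of i] x i by (simp add: m_assoc)
    qed (use bc fc x in auto)
    also have "\<dots> = b \<otimes> (\<Oplus>i\<in>{..<n}. f i \<otimes> x [^] i)"
      using bc fc x by (intro finsum_rdistr[symmetric]) auto
    finally show ?thesis using sum0 bc by simp
  qed
  ultimately show ?thesis
    using algebraic_of_power_sum[OF subfieldE(1)[OF Lxf] y, of g m s0] gL s0 by auto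
qed

definition (in field) algebraic_span :: "'a set \<Rightarrow> 'a set" where
  "algebraic_span A = {x \<in> carrier R. (algebraic over generate_field R A) x}"

lemma (in field) algebraic_span_subset_carrier: "algebraic_span A \<subseteq> carrier R"
  by (auto simp: algebraic_span_def)

lemma (in field) algebraic_span_mono:
  assumes "A \<subseteq> B" "B \<subseteq> carrier R"
  shows "algebraic_span A \<subseteq> algebraic_span B"
  using algebraic_mono[OF mono_generate_field[OF assms]]
  by (auto simp: algebraic_span_def)

lemma (in field) subfield_algebraic_span:
  assumes "A \<subseteq> carrier R" shows "subfield (algebraic_span A) R"
  unfolding algebraic_span_def
  by (rule subfield_of_algebraics[OF generate_field_is_subfield[OF assms]])

lemma (in field) algebraic_span_superset:
  assumes "A \<subseteq> carrier R" shows "A \<subseteq> algebraic_span A"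
proof
  fix x assume "x \<in> A"
  then show "x \<in> algebraic_span A"
    using algebraic_self[OF subfieldE(1)[OF generate_field_is_subfield[OF assms]], of x]
      generate_field.incl[of x A R] assms by (auto simp: algebraic_span_def)
qed

text \<open>Transitivity of algebraicity: an element algebraic over the algebraic span of \<open>A\<close> is algebraic over
the field generated by the finitely many coefficients of its equation, and that field has finite
degree over the one generated by \<open>A\<close>.\<close>

lemma (in field) algebraic_span_idem:
  assumes A: "A \<subseteq> carrier R" shows "algebraic_span (algebraic_span A) \<subseteq> algebraic_span A"
proof
  let ?F = "generate_field R A"
  have F: "subfield ?F R" by (rule generate_field_is_subfield[OF A])
  fix x assume "x \<in> algebraic_span (algebraic_span A)"
  then have x: "x \<in> carrier R" "(algebraic over algebraic_span A) x"
    using subfield_algebraic_span[OF A] by (auto simp: algebraic_span_def[of "algebraic_span A"])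
  then obtain p where p: "p \<in> carrier (algebraic_span A[X])" "p \<noteq> []" "eval p x = \<zero>"
    using algebraicE subfieldE(1)[OF subfield_algebraic_span[OF A]] by blast
  then have sp: "set p \<subseteq> algebraic_span A" and lc: "lead_coeff p \<noteq> \<zero>"
    by (auto simp: univ_poly_carrier[symmetric] polynomial_def)
  let ?L = "finite_extension ?F p"
  have pc: "set p \<subseteq> carrier R" "\<And>c. c \<in> set p \<Longrightarrow> (algebraic over ?F) c"
    using sp by (auto simp: algebraic_span_def)
  have L: "subfield ?L R" using finite_extension_is_subfield[OF F] pc by auto
  have "set p \<subseteq> ?L" using finite_extension_mem[OF subfieldE(1)[OF F] pc(1)] .
  then have "p \<in> carrier (?L[X])" using lc by (simp add: univ_poly_carrier[symmetric] polynomial_def)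
  then have "(algebraic over ?L) x" using p by (intro algebraicI)
  then have "finite_dimension ?L (simple_extension ?L x)"
    using finite_dimension_simple_extension[OF L x(1)] by simp
  then have "finite_dimension ?F (simple_extension ?L x)"
    using telescopic_base_dim(1)[OF F L] finite_extension_finite_dimension(1)[OF F] pc by auto
  then have "(algebraic over ?F) x"
    using finite_dimension_imp_algebraic[OF F simple_extension_is_subring[OF subfieldE(1)[OF L] x(1)]]
      simple_extension_mem[OF subfieldE(1)[OF L] x(1)] by auto
  then show "x \<in> algebraic_span A" using x by (simp add: algebraic_span_def)
qed

lemma (in field) generate_field_insert_generate_field:
  assumes "insert x A \<subseteq> carrier R"
  shows "generate_field R (insert x (generate_field R A)) = generate_field R (insert x A)"
proof (rule antisym)
  have A: "A \<subseteq> carrier R" "insert x (generate_field R A) \<subseteq> carrier R"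
    using assms generate_field_incl[of A] by auto
  have sub: "subfield (generate_field R (insert x A)) R" using generate_field_is_subfield[OF assms] .
  have "generate_field R A \<subseteq> generate_field R (insert x A)"
    using mono_generate_field[of A "insert x A"] assms by auto
  then show "generate_field R (insert x (generate_field R A)) \<subseteq> generate_field R (insert x A)"
    using generate_field_min_subfield1[OF A(2) sub] generate_field.incl[of x "insert x A" R] by auto
  show "generate_field R (insert x A) \<subseteq> generate_field R (insert x (generate_field R A))"
    using mono_generate_field[OF _ A(2), of "insert x A"] generate_field.incl[of _ A R] by auto
qed

lemma (in field) algebraic_span_exchange:
  assumes "A \<subseteq> carrier R" "y \<in> carrier R"
    and x: "x \<in> algebraic_span (insert y A)" "x \<notin> algebraic_span A"
  shows "y \<in> algebraic_span (insert x A)"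
proof -
  have xc: "x \<in> carrier R" using x(1) by (simp add: algebraic_span_def)
  show ?thesis
    using algebraic_exchange[OF generate_field_is_subfield[OF assms(1)] xc assms(2)] assms xc
    by (simp add: algebraic_span_def generate_field_insert_generate_field)
qed

text \<open>The sequence \<open>a\<close> is independent over \<open>A\<close>, each member being outside the span of \<open>A\<close> and
its predecessors. Its last member \<open>a\<^sub>d\<close> shows that \<open>K0\<close> is not contained in the span of
\<open>A\<close> and \<open>a\<^sub>0, \<dots>, a\<^sub>d\<^sub>-\<^sub>1\<close>, so some \<open>t\<close> in \<open>K0\<close> can take its place. By exchange the
first \<open>d\<close> members stay independent over \<open>A\<close> and \<open>t\<close>, and the induction hypothesis applies to them.\<close>

lemma (in field) steinitz_exchange:
  fixes d :: nat
  assumes "A \<subseteq> K0" "K0 \<subseteq> carrier R" "\<And>i. i < d \<Longrightarrow> a i \<in> algebraic_span K0"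
    and "\<And>i. i < d \<Longrightarrow> a i \<notin> algebraic_span (A \<union> a ` {..<i})"
  shows "\<exists>s. (\<forall>i<d. s i \<in> K0 \<and> s i \<notin> algebraic_span (A \<union> s ` {..<i}))"
  using assms(1,3,4)
proof (induction d arbitrary: A)
  case 0
  then show ?case by simp
next
  case (Suc d)
  have ac: "a i \<in> carrier R" if "i < Suc d" for i
    using Suc.prems(2)[OF that] algebraic_span_subset_carrier by auto
  have Ac: "A \<subseteq> carrier R" using Suc.prems assms(2) by auto
  let ?B = "A \<union> a ` {..<d}"
  have B: "?B \<subseteq> carrier R" using Ac ac by auto
  have "\<not> K0 \<subseteq> algebraic_span ?B"
  proof
    assume "K0 \<subseteq> algebraic_span ?B"
    then have "algebraic_span K0 \<subseteq> algebraic_span ?B"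
      using algebraic_span_mono[of K0 "algebraic_span ?B"] algebraic_span_idem[OF B]
        algebraic_span_subset_carrier[of ?B] by auto
    then show False using Suc.prems(2,3)[of d] by auto
  qed
  then obtain t where t: "t \<in> K0" "t \<notin> algebraic_span ?B" by auto
  have tc: "t \<in> carrier R" using t assms(2) by auto
  have "\<exists>s. \<forall>i<d. s i \<in> K0 \<and> s i \<notin> algebraic_span (insert t A \<union> s ` {..<i})"
  proof (rule Suc.IH)
    show "insert t A \<subseteq> K0" using t Suc.prems by auto
    show "a i \<in> algebraic_span K0" if "i < d" for i using Suc.prems that by auto
    show "a i \<notin> algebraic_span (insert t A \<union> a ` {..<i})" if i: "i < d" for i
    proof
      let ?C = "A \<union> a ` {..<i}"
      assume "a i \<in> algebraic_span (insert t A \<union> a ` {..<i})"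
      moreover have C: "?C \<subseteq> carrier R" using Ac ac i by auto
      ultimately have "t \<in> algebraic_span (insert (a i) ?C)"
        using algebraic_span_exchange[OF C tc, of "a i"] Suc.prems(3)[of i] i by auto
      moreover have "algebraic_span (insert (a i) ?C) \<subseteq> algebraic_span ?B"
        using i B by (intro algebraic_span_mono) auto
      ultimately show False using t by auto
    qed
  qed
  then obtain s where s: "\<forall>i<d. s i \<in> K0 \<and> s i \<notin> algebraic_span (insert t A \<union> s ` {..<i})" ..
  define s' where "s' = case_nat t s"
  have "s' ` {..<Suc i} = insert t (s ` {..<i})" for i
    unfolding s'_def lessThan_Suc_eq_insert_0 by (auto simp: image_image)
  moreover have "t \<notin> algebraic_span A" using t algebraic_span_mono[OF _ B, of A] by auto
  ultimately have "\<forall>i<Suc d. s' i \<in> K0 \<and> s' i \<notin> algebraic_span (A \<union> s' ` {..<i})"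
    using s t by (auto simp: s'_def less_Suc_eq_0_disj)
  then show ?case by blast
qed

section \<open>A lower bound for the transcendence degree\<close>

text \<open>A polynomial relation among \<open>S\<close> and \<open>x\<close> is sorted by powers of \<open>x\<close>. Its coefficients
are polynomials in \<open>S\<close>, hence vanish because \<open>x\<close> is transcendental over \<open>F(S)\<close>, and then the
independence of \<open>S\<close> makes the original coefficients vanish.\<close>

lemma (in field) algebraically_independent_insert:
  assumes S: "algebraically_independent R F S" and F: "subring F R"
    and x: "x \<in> carrier R" "x \<notin> algebraic_span (F \<union> S)"
  shows "algebraically_independent R F (insert x S)"
  unfolding algebraically_independent_def
proof (intro conjI allI impI)
  have Sc: "S \<subseteq> carrier R" using S by (simp add: algebraically_independent_def)
  note FE = subringE[OF F]
  have FS: "F \<union> S \<subseteq> carrier R" using Sc FE by auto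
  show "insert x S \<subseteq> carrier R" using x Sc by auto
  have xS: "x \<notin> S" using x(2) algebraic_span_superset[OF FS] by auto
  let ?L = "generate_field R (F \<union> S)"
  have L: "subring ?L R" using subfieldE(1)[OF generate_field_is_subfield[OF FS]] .
  note LE = subringE[OF L]
  have incl: "F \<union> S \<subseteq> ?L" by (auto intro: generate_field.incl)
  fix M c
  assume M: "finite M" "\<forall>m\<in>M. set_mset m \<subseteq> insert x S" and c: "c \<in> M \<rightarrow> F"
    and sum0: "(\<Oplus>m\<in>M. c m \<otimes> monomial_value R m) = \<zero>"
  (* the factor of a monomial that is prime to x *)
  define r where "r = (\<lambda>m. filter_mset (\<lambda>y. y \<noteq> x) m)"
  have powL: "y \<in> ?L \<Longrightarrow> y [^] (n::nat) \<in> ?L" for y n by (induction n) (use LE in auto)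
  have prodL: "(\<Otimes>s\<in>A. f s) \<in> ?L" if "f \<in> A \<rightarrow> ?L" for f :: "'a \<Rightarrow> 'a" and A
    using that
  proof (induction A rule: infinite_finite_induct)
    case (insert a A)
    then have "f \<in> A \<rightarrow> carrier R" "f a \<in> carrier R" using LE(1) by auto
    then show ?case using insert LE(6) by auto
  qed (use LE(3) in auto)
  have rS: "set_mset (r m) \<subseteq> S" if "m \<in> M" for m using M that by (auto simp: r_def)
  have rL: "monomial_value R (r m) \<in> ?L" if "m \<in> M" for m
    unfolding monomial_value_def using rS[OF that] incl by (intro prodL) (auto intro!: powL)
  have rc: "monomial_value R (r m) \<in> carrier R" if "m \<in> M" for m using rL[OF that] LE(1) by auto
  have cc: "c m \<in> carrier R" "c m \<in> ?L" if "m \<in> M" for m using c that FE incl by auto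
  have split: "monomial_value R m = monomial_value R (r m) \<otimes> x [^] count m x" if m: "m \<in> M" for m
  proof -
    have carr: "s \<in> carrier R" if "s \<in># m" for s using that m M Sc x by auto
    have eq: "(\<Otimes>s\<in>set_mset (r m). s [^] count (r m) s) = (\<Otimes>s\<in>set_mset (r m). s [^] count m s)"
      using carr by (intro finprod_cong') (auto simp: r_def)
    show ?thesis
    proof (cases "x \<in># m")
      case True
      then have "set_mset m = insert x (set_mset (r m))" by (auto simp: r_def)
      moreover have "x \<notin> set_mset (r m)" by (simp add: r_def)
      ultimately have "monomial_value R m = x [^] count m x \<otimes> (\<Otimes>s\<in>set_mset (r m). s [^] count m s)"
        using carr x(1) unfolding monomial_value_def by simp
      then show ?thesis using eq rc[OF m] x by (simp add: monomial_value_def m_comm)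
    next
      case False
      then have "r m = m" by (auto simp: r_def filter_mset_eq_conv)
      then show ?thesis using False rc[OF m] by (simp add: not_in_iff)
    qed
  qed
  define n where "n = Suc (\<Sum>m\<in>M. count m x)"
  have n: "count m x < n" if "m \<in> M" for m
    unfolding n_def using member_le_sum[OF that, of "\<lambda>m. count m x"] M(1) by auto
  define g where "g = (\<lambda>j. \<Oplus>m\<in>{m\<in>M. count m x = j}. c m \<otimes> monomial_value R (r m))"
  have gL: "g j \<in> ?L" for j
    unfolding g_def using cc rL LE(6) by (intro finsum_in_subring[OF L]) auto
  have gif: "g j = (\<Oplus>m\<in>M. if count m x = j then c m \<otimes> monomial_value R (r m) else \<zero>)" for j
    unfolding g_def using M(1) cc rc
    by (intro add.finprod_mono_neutral_cong_left) auto
  have "(\<Oplus>j\<in>{..<n}. g j \<otimes> x [^] j)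
     = (\<Oplus>j\<in>{..<n}. \<Oplus>m\<in>M. if count m x = j then c m \<otimes> monomial_value R m else \<zero>)"
  proof (intro finsum_cong' refl)
    fix j
    have "g j \<otimes> x [^] j
       = (\<Oplus>m\<in>M. (if count m x = j then c m \<otimes> monomial_value R (r m) else \<zero>) \<otimes> x [^] j)"
      unfolding gif using M(1) cc rc x by (intro finsum_ldistr) auto
    also have "\<dots> = (\<Oplus>m\<in>M. if count m x = j then c m \<otimes> monomial_value R m else \<zero>)"
      using cc rc x split by (intro finsum_cong') (auto simp: m_assoc)
    finally show "g j \<otimes> x [^] j = (\<Oplus>m\<in>M. if count m x = j then c m \<otimes> monomial_value R m else \<zero>)" .
  qed (use cc rc x split in \<open>auto intro!: finsum_closed\<close>)
  also have "\<dots> = (\<Oplus>m\<in>M. \<Oplus>j\<in>{..<n}. if count m x = j then c m \<otimes> monomial_value R m else \<zero>)"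
    using M(1) cc rc x split by (intro finsum_swap) auto
  also have "\<dots> = (\<Oplus>m\<in>M. c m \<otimes> monomial_value R m)"
    using cc rc x split n by (intro finsum_cong') (auto simp: finsum_singleton)
  finally have "(\<Oplus>j\<in>{..<n}. g j \<otimes> x [^] j) = \<zero>" using sum0 by simp
  then have g0: "g j = \<zero>" if "j < n" for j
    using algebraic_of_power_sum[OF L x(1), of g n j] gL that x by (auto simp: algebraic_span_def)
  show "\<forall>m\<in>M. c m = \<zero>"
  proof
    fix m0 assume m0: "m0 \<in> M"
    (* the monomials with the same exponent of x as m0 are determined by their remaining factors *)
    define j where "j = count m0 x"
    define N where "N = {m\<in>M. count m x = j}"
    have restore: "r m + replicate_mset j x = m" if "m \<in> N" for m
      using that by (intro multiset_eqI) (auto simp: N_def r_def)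
    have inj: "inj_on r N" by (rule inj_on_inverseI[where g = "\<lambda>m. m + replicate_mset j x"]) (rule restore)
    let ?c = "\<lambda>m. c (m + replicate_mset j x)"
    have "(\<Oplus>m\<in>r ` N. ?c m \<otimes> monomial_value R m) = (\<Oplus>m\<in>N. ?c (r m) \<otimes> monomial_value R (r m))"
      using cc rc restore inj by (intro finsum_reindex) (auto simp: N_def)
    also have "\<dots> = g j"
      unfolding g_def N_def[symmetric] using cc rc restore
      by (intro finsum_cong') (auto simp: N_def)
    also have "\<dots> = \<zero>" using g0 n[OF m0] by (simp add: j_def)
    finally have "(\<Oplus>m\<in>r ` N. ?c m \<otimes> monomial_value R m) = \<zero>" .
    moreover have "finite (r ` N)" "\<forall>m\<in>r ` N. set_mset m \<subseteq> S" "?c \<in> r ` N \<rightarrow> F"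
      using M(1) rS c restore by (auto simp: N_def)
    ultimately have "\<forall>m\<in>r ` N. ?c m = \<zero>"
      using S unfolding algebraically_independent_def by blast
    moreover have "m0 \<in> N" using m0 by (simp add: N_def j_def)
    ultimately show "c m0 = \<zero>" using restore by force
  qed
qed

lemma (in field) algebraically_independent_empty:
  assumes "F \<subseteq> carrier R"
  shows "algebraically_independent R F {}"
  unfolding algebraically_independent_def
proof (intro conjI allI impI)
  fix M c assume M: "finite M" "\<forall>m\<in>M. set_mset m \<subseteq> ({} :: 'a set)" and c: "c \<in> M \<rightarrow> F"
    and sum0: "(\<Oplus>m\<in>M. c m \<otimes> monomial_value R m) = \<zero>"
  have "M \<subseteq> {{#}}" using M by auto
  then show "\<forall>m\<in>M. c m = \<zero>"
    using sum0 c assms by (auto simp: subset_singleton_iff monomial_value_def)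
qed auto

lemma (in field) algebraically_independent_of_chain:
  fixes d :: nat
  assumes F: "subring F R"
    and "\<And>i. i < d \<Longrightarrow> s i \<in> carrier R" "\<And>i. i < d \<Longrightarrow> s i \<notin> algebraic_span (F \<union> s ` {..<i})"
  shows "algebraically_independent R F (s ` {..<d}) \<and> card (s ` {..<d}) = d"
  using assms(2,3)
proof (induction d)
  case 0
  then show ?case using algebraically_independent_empty subringE(1)[OF F] by simp
next
  case (Suc d)
  have IH: "algebraically_independent R F (s ` {..<d})" "card (s ` {..<d}) = d" using Suc by auto
  have "F \<union> s ` {..<d} \<subseteq> carrier R" using Suc.prems subringE(1)[OF F] by auto
  then have "s d \<notin> s ` {..<d}" using Suc.prems(2)[of d] algebraic_span_superset by blast
  then show ?case
    using algebraically_independent_insert[OF IH(1) F] Suc.prems IH(2)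
    by (auto simp: lessThan_Suc)
qed

text \<open>Steinitz exchange moves the independent sequence \<open>a\<close> into \<open>L\<close>. This is how independent parameters
that are algebraic over a field of definition bound its transcendence degree from below.\<close>

lemma (in field) trdeg_ge:
  fixes d :: nat
  assumes F: "subring F R" and "F \<subseteq> L" "L \<subseteq> carrier R"
    and "\<And>i. i < d \<Longrightarrow> a i \<in> algebraic_span L"
    and "\<And>i. i < d \<Longrightarrow> a i \<notin> algebraic_span (F \<union> a ` {..<i})"
  shows "enat d \<le> trdeg R F L"
proof -
  obtain s where s: "\<forall>i<d. s i \<in> L \<and> s i \<notin> algebraic_span (F \<union> s ` {..<i})"
    using steinitz_exchange[OF assms(2-5)] by blast
  then have "algebraically_independent R F (s ` {..<d}) \<and> card (s ` {..<d}) = d"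
    using algebraically_independent_of_chain[OF F, of d s] assms(3) by blast
  moreover have "s ` {..<d} \<subseteq> L" using s by auto
  ultimately show ?thesis unfolding trdeg_def by (intro Sup_upper CollectI exI[of _ "s ` {..<d}"]) auto
qed

section \<open>Roots of matrix pencils over a subfield\<close>

text \<open>Comparison of coefficients in \<open>x p(x) = q(x)\<close> for a transcendental \<open>x\<close>; \<open>p\<close> and \<open>q\<close> are
coefficient sequences that vanish from \<open>n\<close> on.\<close>

lemma (in domain) power_sum_shift_eq:
  fixes n :: nat
  assumes L: "subring L R" and x: "x \<in> carrier R" and trans: "\<not> (algebraic over L) x"
    and p: "\<And>s. p s \<in> L" "\<And>s. n \<le> s \<Longrightarrow> p s = \<zero>"
    and q: "\<And>s. q s \<in> L" "\<And>s. n \<le> s \<Longrightarrow> q s = \<zero>"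
    and eq: "x \<otimes> (\<Oplus>s\<in>{..<n}. p s \<otimes> x [^] s) = (\<Oplus>s\<in>{..<n}. q s \<otimes> x [^] s)"
  shows "q 0 = \<zero>" "p s = q (Suc s)"
proof -
  note LE = subringE[OF L]
  have pc: "p s \<in> carrier R" and qc: "q s \<in> carrier R" for s using p(1) q(1) LE(1) by auto
  (* the coefficients of x p(x) - q(x) *)
  define w where "w = (\<lambda>s. (case s of 0 \<Rightarrow> \<zero> | Suc t \<Rightarrow> p t) \<ominus> q s)"
  have wL: "w s \<in> L" for s
    using p(1) q(1) LE by (cases s) (auto simp: w_def a_minus_def)
  have "(\<Oplus>s\<in>{..n}. case s of 0 \<Rightarrow> \<zero> | Suc t \<Rightarrow> p t \<otimes> x [^] Suc t)
      = (\<Oplus>s\<in>Suc ` {..<n}. case s of 0 \<Rightarrow> \<zero> | Suc t \<Rightarrow> p t \<otimes> x [^] Suc t)"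
    using pc x
    by (intro add.finprod_mono_neutral_cong_right) (auto split: nat.splits simp: image_iff Bex_def less_eq_Suc_le)
  also have "\<dots> = (\<Oplus>s\<in>{..<n}. p s \<otimes> x [^] Suc s)"
    using pc x by (subst finsum_reindex) auto
  also have "\<dots> = (\<Oplus>s\<in>{..<n}. x \<otimes> (p s \<otimes> x [^] s))"
    using pc x by (intro finsum_cong') (auto simp: m_assoc m_comm m_lcomm)
  also have "\<dots> = x \<otimes> (\<Oplus>s\<in>{..<n}. p s \<otimes> x [^] s)"
    using pc x by (intro finsum_rdistr[symmetric]) auto
  finally have A: "(\<Oplus>s\<in>{..n}. case s of 0 \<Rightarrow> \<zero> | Suc t \<Rightarrow> p t \<otimes> x [^] Suc t)
     = (\<Oplus>s\<in>{..<n}. q s \<otimes> x [^] s)" using eq by simp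
  have B: "(\<Oplus>s\<in>{..n}. q s \<otimes> x [^] s) = (\<Oplus>s\<in>{..<n}. q s \<otimes> x [^] s)"
    using qc q(2) x by (intro add.finprod_mono_neutral_cong_right) auto
  have "(\<Oplus>s\<in>{..n}. w s \<otimes> x [^] s) = (\<Oplus>s\<in>{..n}. (case s of 0 \<Rightarrow> \<zero> | Suc t \<Rightarrow> p t \<otimes> x [^] Suc t)
     \<oplus> (\<ominus> \<one>) \<otimes> (q s \<otimes> x [^] s))"
  proof (intro finsum_cong' refl)
    fix s
    show "w s \<otimes> x [^] s = (case s of 0 \<Rightarrow> \<zero> | Suc t \<Rightarrow> p t \<otimes> x [^] Suc t) \<oplus> (\<ominus> \<one>) \<otimes> (q s \<otimes> x [^] s)"
      using pc qc x unfolding w_def a_minus_def by (cases s) (auto simp: l_distr l_minus)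
  qed (use pc qc x in \<open>auto split: nat.splits\<close>)
  also have "\<dots> = (\<Oplus>s\<in>{..n}. case s of 0 \<Rightarrow> \<zero> | Suc t \<Rightarrow> p t \<otimes> x [^] Suc t)
     \<oplus> (\<Oplus>s\<in>{..n}. (\<ominus> \<one>) \<otimes> (q s \<otimes> x [^] s))"
    using pc qc x by (intro finsum_addf) (auto split: nat.splits)
  also have "(\<Oplus>s\<in>{..n}. (\<ominus> \<one>) \<otimes> (q s \<otimes> x [^] s)) = (\<ominus> \<one>) \<otimes> (\<Oplus>s\<in>{..n}. q s \<otimes> x [^] s)"
    using qc x by (intro finsum_rdistr[symmetric]) auto
  finally have "(\<Oplus>s\<in>{..n}. w s \<otimes> x [^] s) = \<zero>"
    unfolding A B using qc x by (simp add: l_minus finsum_closed r_neg Pi_def)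
  then have sum: "(\<Oplus>s\<in>{..<Suc n}. w s \<otimes> x [^] s) = \<zero>" by (simp add: lessThan_Suc_atMost)
  have w0: "w s = \<zero>" for s
  proof (cases "s < Suc n")
    case True
    then show ?thesis
      using algebraic_of_power_sum[OF L x _ sum True] trans wL by auto
  next
    case False
    then show ?thesis using p(2)[of "s - 1"] q(2)[of s] by (cases s) (auto simp: w_def)
  qed
  show "q 0 = \<zero>" using w0[of 0] qc[of 0] by (simp add: w_def a_minus_def add.inv_eq_1_iff)
  show "p s = q (Suc s)" using w0[of "Suc s"] pc[of s] qc[of "Suc s"] by (simp add: w_def)
qed

text \<open>The heart of the argument, for a null vector of the pencil whose entries are polynomials in \<open>x\<close>: write
it as \<open>\<Sum>\<^sub>s x\<^sup>s v\<^sub>s\<close> with \<open>v\<^sub>s\<close> over \<open>L\<close>. Comparing coefficients gives \<open>X2 v\<^sub>0 = 0\<close> and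
\<open>X1 v\<^sub>s = X2 v\<^sub>s\<^sub>+\<^sub>1\<close>, and \<open>l X2 = x l X1\<close> carries the vanishing of \<open>l X1 v\<^sub>s\<close> from each \<open>s\<close> to the
next.\<close>

lemma (in domain) kernel_vector_annihilated:
  fixes N :: nat
  assumes L: "subring L R" and x: "x \<in> carrier R" and trans: "\<not> (algebraic over L) x"
    and X: "\<And>i j. i < N \<Longrightarrow> j < N \<Longrightarrow> X1 i j \<in> L" "\<And>i j. i < N \<Longrightarrow> j < N \<Longrightarrow> X2 i j \<in> L"
    and l: "\<And>i. i < N \<Longrightarrow> l i \<in> carrier R"
    and c: "\<And>j. j < N \<Longrightarrow> c j \<in> simple_extension L x"
    and ker: "\<And>i. i < N \<Longrightarrow> x \<otimes> (\<Oplus>j\<in>{..<N}. X1 i j \<otimes> c j) = (\<Oplus>j\<in>{..<N}. X2 i j \<otimes> c j)"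
    and left: "\<And>j. j < N \<Longrightarrow> (\<Oplus>i\<in>{..<N}. l i \<otimes> X2 i j) = x \<otimes> (\<Oplus>i\<in>{..<N}. l i \<otimes> X1 i j)"
  shows "(\<Oplus>i\<in>{..<N}. l i \<otimes> (\<Oplus>j\<in>{..<N}. X1 i j \<otimes> c j)) = \<zero>"
proof -
  note LE = subringE[OF L]
  have Xc: "X1 i j \<in> carrier R" "X2 i j \<in> carrier R" if "i < N" "j < N" for i j
    using X[OF that] LE(1) by auto
  have "\<exists>(n::nat) f. \<forall>j\<in>{..<N}. (\<forall>s. f j s \<in> L) \<and> c j = (\<Oplus>s\<in>{..<n}. f j s \<otimes> x [^] s)"
    by (rule simple_extension_as_power_sums[OF L x finite_lessThan]) (use c in auto)
  then obtain n :: nat and f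
    where f: "\<forall>j\<in>{..<N}. (\<forall>s. f j s \<in> L) \<and> c j = (\<Oplus>s\<in>{..<n}. f j s \<otimes> x [^] s)" by (elim exE)
  (* padding with zeros makes the recursion below hold without a bound on s *)
  define v where "v = (\<lambda>j s. if s < n then f j s else \<zero>)"
  have vL: "v j s \<in> L" if "j < N" for j s using f that LE by (auto simp: v_def)
  have vc: "v j s \<in> carrier R" if "j < N" for j s using vL[OF that] LE(1) by auto
  have cv: "c j = (\<Oplus>s\<in>{..<n}. v j s \<otimes> x [^] s)" if "j < N" for j
    using f that vc[OF that] x by (auto simp: v_def intro!: finsum_cong')
  define p where "p = (\<lambda>i s. \<Oplus>j\<in>{..<N}. X1 i j \<otimes> v j s)"
  define q where "q = (\<lambda>i s. \<Oplus>j\<in>{..<N}. X2 i j \<otimes> v j s)"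
  have pL: "p i s \<in> L" and qL: "q i s \<in> L" if "i < N" for i s
    unfolding p_def q_def using X that vL LE by (auto intro!: finsum_in_subring[OF L])
  have pc: "p i s \<in> carrier R" and qc: "q i s \<in> carrier R" if "i < N" for i s
    using pL[OF that] qL[OF that] LE(1) by auto
  have p0: "p i s = \<zero>" and q0: "q i s = \<zero>" if "i < N" "n \<le> s" for i s
    unfolding p_def q_def using Xc that by (auto simp: v_def intro!: add.finprod_one_eqI)
  have X1c: "(\<Oplus>j\<in>{..<N}. X1 i j \<otimes> c j) = (\<Oplus>s\<in>{..<n}. p i s \<otimes> x [^] s)"
   and X2c: "(\<Oplus>j\<in>{..<N}. X2 i j \<otimes> c j) = (\<Oplus>s\<in>{..<n}. q i s \<otimes> x [^] s)" if i: "i < N" for i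
  proof -
    have "(\<Oplus>j\<in>{..<N}. X1 i j \<otimes> c j) = (\<Oplus>j\<in>{..<N}. X1 i j \<otimes> (\<Oplus>s\<in>{..<n}. v j s \<otimes> x [^] s))"
      using Xc i vc x cv by (intro finsum_cong') (auto intro!: finsum_closed)
    then show "(\<Oplus>j\<in>{..<N}. X1 i j \<otimes> c j) = (\<Oplus>s\<in>{..<n}. p i s \<otimes> x [^] s)"
      unfolding p_def using Xc i vc x by (subst (asm) finsum_mult_assoc) auto
    have "(\<Oplus>j\<in>{..<N}. X2 i j \<otimes> c j) = (\<Oplus>j\<in>{..<N}. X2 i j \<otimes> (\<Oplus>s\<in>{..<n}. v j s \<otimes> x [^] s))"
      using Xc i vc x cv by (intro finsum_cong') (auto intro!: finsum_closed)
    then show "(\<Oplus>j\<in>{..<N}. X2 i j \<otimes> c j) = (\<Oplus>s\<in>{..<n}. q i s \<otimes> x [^] s)"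
      unfolding q_def using Xc i vc x by (subst (asm) finsum_mult_assoc) auto
  qed
  have rec: "q i 0 = \<zero>" "p i s = q i (Suc s)" if i: "i < N" for i s
  proof -
    have "x \<otimes> (\<Oplus>s\<in>{..<n}. p i s \<otimes> x [^] s) = (\<Oplus>s\<in>{..<n}. q i s \<otimes> x [^] s)"
      using ker[OF i] unfolding X1c[OF i] X2c[OF i] .
    note shift = power_sum_shift_eq[OF L x trans pL[OF i] p0[OF i] qL[OF i] q0[OF i] this]
    show "q i 0 = \<zero>" by (rule shift(1))
    show "p i s = q i (Suc s)" by (rule shift(2))
  qed
  (* p, q and P are X1 v, X2 v and l X1 v, coefficientwise *)
  define P where "P = (\<lambda>s. \<Oplus>i\<in>{..<N}. l i \<otimes> p i s)"
  have Pc: "P s \<in> carrier R" for s unfolding P_def using l pc by (auto intro!: finsum_closed)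
  have lq: "(\<Oplus>i\<in>{..<N}. l i \<otimes> q i s) = x \<otimes> P s" for s
  proof -
    have "(\<Oplus>i\<in>{..<N}. l i \<otimes> q i s) = (\<Oplus>j\<in>{..<N}. (\<Oplus>i\<in>{..<N}. l i \<otimes> X2 i j) \<otimes> v j s)"
      unfolding q_def using l Xc vc by (intro finsum_mult_assoc) auto
    also have "\<dots> = (\<Oplus>j\<in>{..<N}. x \<otimes> ((\<Oplus>i\<in>{..<N}. l i \<otimes> X1 i j) \<otimes> v j s))"
    proof (intro finsum_cong' refl)
      fix j assume "j \<in> {..<N}"
      then show "(\<Oplus>i\<in>{..<N}. l i \<otimes> X2 i j) \<otimes> v j s = x \<otimes> ((\<Oplus>i\<in>{..<N}. l i \<otimes> X1 i j) \<otimes> v j s)"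
        using left[of j] l Xc vc[of j s] x by (simp add: m_assoc finsum_closed Pi_def)
    qed (use l Xc vc x in \<open>auto intro!: finsum_closed\<close>)
    also have "\<dots> = x \<otimes> (\<Oplus>j\<in>{..<N}. (\<Oplus>i\<in>{..<N}. l i \<otimes> X1 i j) \<otimes> v j s)"
      using l Xc vc x by (intro finsum_rdistr[symmetric]) (auto intro!: finsum_closed)
    also have "(\<Oplus>j\<in>{..<N}. (\<Oplus>i\<in>{..<N}. l i \<otimes> X1 i j) \<otimes> v j s) = P s"
      unfolding P_def p_def using l Xc vc by (intro finsum_mult_assoc[symmetric]) auto
    finally show ?thesis .
  qed
  have x0: "x \<noteq> \<zero>" using trans zero_is_algebraic[OF L] by auto
  have P0: "P s = \<zero>" for s
  proof (induction s)
    case 0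
    have "x \<otimes> P 0 = \<zero>"
      unfolding lq[symmetric] using rec l by (auto intro!: add.finprod_one_eqI)
    then show ?case using x0 x Pc integral_iff by auto
  next
    case (Suc s)
    have "(\<Oplus>i\<in>{..<N}. l i \<otimes> q i (Suc s)) = P s"
      unfolding P_def using rec(2) l pc by (intro finsum_cong') auto
    then have "x \<otimes> P (Suc s) = P s" unfolding lq .
    then show ?case using Suc x0 x Pc integral_iff by auto
  qed
  have "(\<Oplus>i\<in>{..<N}. l i \<otimes> (\<Oplus>j\<in>{..<N}. X1 i j \<otimes> c j))
      = (\<Oplus>i\<in>{..<N}. l i \<otimes> (\<Oplus>s\<in>{..<n}. p i s \<otimes> x [^] s))"
    using l pc x X1c by (intro finsum_cong') (auto intro!: finsum_closed)
  also have "\<dots> = (\<Oplus>s\<in>{..<n}. P s \<otimes> x [^] s)"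
    unfolding P_def using l pc x by (intro finsum_mult_assoc) auto
  also have "\<dots> = \<zero>" using P0 x by (auto intro!: add.finprod_one_eqI)
  finally show ?thesis .
qed

text \<open>As long as the elements \<open>b\<^sub>l\<close> satisfy a linear relation over \<open>S\<close>, one of them can be
dropped. Rescaling the others by the inverse of the coefficient of the dropped one keeps all
coefficients inside the ring \<open>S\<close>: its fraction field never enters.\<close>

lemma (in field) independent_expansion_aux:
  fixes I :: "'i set"
  assumes S: "subring S R" and "finite I"
    and "\<And>l. l \<in> I \<Longrightarrow> b l \<in> carrier R" "\<And>j l. j \<in> J \<Longrightarrow> l \<in> I \<Longrightarrow> c j l \<in> S"
    and "\<And>j. j \<in> J \<Longrightarrow> u j = (\<Oplus>l\<in>I. c j l \<otimes> b l)"
  shows "\<exists>(I :: 'i set) b c. finite I \<and> (\<forall>l\<in>I. b l \<in> carrier R) \<and> (\<forall>j\<in>J. \<forall>l\<in>I. c j l \<in> S) \<and>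
     (\<forall>j\<in>J. u j = (\<Oplus>l\<in>I. c j l \<otimes> b l)) \<and>
     (\<forall>d. d \<in> I \<rightarrow> S \<longrightarrow> (\<Oplus>l\<in>I. d l \<otimes> b l) = \<zero> \<longrightarrow> (\<forall>l\<in>I. d l = \<zero>))"
  using assms(2-)
proof (induction I arbitrary: b c rule: finite_psubset_induct)
  case (psubset I)
  note SE = subringE[OF S]
  show ?case
  proof (cases "\<forall>d. d \<in> I \<rightarrow> S \<longrightarrow> (\<Oplus>l\<in>I. d l \<otimes> b l) = \<zero> \<longrightarrow> (\<forall>l\<in>I. d l = \<zero>)")
    case True
    then show ?thesis
      using \<open>finite I\<close> psubset.prems by (intro exI[of _ I] exI[of _ b] exI[of _ c] conjI) blast+
  next
    case False
    then obtain d l0 where d: "d \<in> I \<rightarrow> S" "(\<Oplus>l\<in>I. d l \<otimes> b l) = \<zero>" and l0: "l0 \<in> I" "d l0 \<noteq> \<zero>"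
      by blast
    have dc: "d l \<in> carrier R" if "l \<in> I" for l using d that SE(1) by auto
    have cc: "c j l \<in> carrier R" if "j \<in> J" "l \<in> I" for j l using psubset.prems(2)[OF that] SE(1) by auto
    have bc: "b l \<in> carrier R" if "l \<in> I" for l using psubset.prems(1)[OF that] .
    define e where "e = inv (d l0)"
    have e: "e \<in> carrier R" "d l0 \<otimes> e = \<one>" using dc[OF l0(1)] l0 by (auto simp: e_def field_Units)
    let ?b = "\<lambda>l. e \<otimes> b l"
    let ?c = "\<lambda>j l. c j l \<otimes> d l0 \<ominus> c j l0 \<otimes> d l"
    show ?thesis
    proof (rule psubset.IH[of "I - {l0}" ?b ?c])
      show "I - {l0} \<subset> I" using l0 by auto
      show "e \<otimes> b l \<in> carrier R" if "l \<in> I - {l0}" for l using that bc e by auto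
      show "?c j l \<in> S" if "j \<in> J" "l \<in> I - {l0}" for j l
        unfolding a_minus_def using that d(1) l0 psubset.prems(2)
        by (intro SE(7) SE(6) SE(5)) auto
      show "u j = (\<Oplus>l\<in>I - {l0}. ?c j l \<otimes> ?b l)" if j: "j \<in> J" for j
      proof -
        have "(\<Oplus>l\<in>I - {l0}. ?c j l \<otimes> ?b l) = (\<Oplus>l\<in>I. ?c j l \<otimes> ?b l)"
          using \<open>finite I\<close> cc[OF j] dc bc e l0
          by (intro add.finprod_mono_neutral_cong_left) (auto simp: a_minus_def r_neg)
        also have "\<dots> = (\<Oplus>l\<in>I. c j l \<otimes> b l \<oplus> (\<ominus> (c j l0 \<otimes> e)) \<otimes> (d l \<otimes> b l))"
        proof (intro finsum_cong' refl)
          fix l assume l: "l \<in> I"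
          have "?c j l \<otimes> ?b l = c j l \<otimes> b l \<otimes> (d l0 \<otimes> e) \<oplus> (\<ominus> (c j l0 \<otimes> e)) \<otimes> (d l \<otimes> b l)"
            using cc[OF j l] cc[OF j l0(1)] dc[OF l] dc[OF l0(1)] bc[OF l] e(1) by algebra
          then show "?c j l \<otimes> ?b l = c j l \<otimes> b l \<oplus> (\<ominus> (c j l0 \<otimes> e)) \<otimes> (d l \<otimes> b l)"
            using e cc[OF j l] bc[OF l] by simp
        qed (use cc[OF j] dc bc e l0 in auto)
        also have "\<dots> = (\<Oplus>l\<in>I. c j l \<otimes> b l) \<oplus> (\<Oplus>l\<in>I. (\<ominus> (c j l0 \<otimes> e)) \<otimes> (d l \<otimes> b l))"
          using cc[OF j] dc bc e l0 by (intro finsum_addf) auto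
        also have "(\<Oplus>l\<in>I. (\<ominus> (c j l0 \<otimes> e)) \<otimes> (d l \<otimes> b l)) = (\<ominus> (c j l0 \<otimes> e)) \<otimes> (\<Oplus>l\<in>I. d l \<otimes> b l)"
          using \<open>finite I\<close> cc[OF j] dc bc e l0 by (intro finsum_rdistr[symmetric]) auto
        finally show ?thesis
          using d(2) psubset.prems(3)[OF j] cc[OF j] bc e l0 by (simp add: finsum_closed Pi_def)
      qed
    qed
  qed
qed

text \<open>This splits a solution \<open>u\<close> of a homogeneous linear system over \<open>S\<close> into solutions with entries in \<open>S\<close>:
by the independence of the \<open>b\<^sub>l\<close>, each coefficient vector \<open>c\<^sub>l\<close> solves the system.\<close>

lemma (in field) independent_expansion:
  fixes J :: "'i set"
  assumes S: "subring S R" and "finite J" and u: "\<And>j. j \<in> J \<Longrightarrow> u j \<in> carrier R"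
  shows "\<exists>(I :: 'i set) b c. finite I \<and> (\<forall>l\<in>I. b l \<in> carrier R) \<and> (\<forall>j\<in>J. \<forall>l\<in>I. c j l \<in> S) \<and>
     (\<forall>j\<in>J. u j = (\<Oplus>l\<in>I. c j l \<otimes> b l)) \<and>
     (\<forall>d. d \<in> I \<rightarrow> S \<longrightarrow> (\<Oplus>l\<in>I. d l \<otimes> b l) = \<zero> \<longrightarrow> (\<forall>l\<in>I. d l = \<zero>))"
proof (rule independent_expansion_aux[OF S assms(2)])
  show "u j \<in> carrier R" if "j \<in> J" for j using u that .
  show "(if j = l then \<one> else \<zero>) \<in> S" for j l :: 'i using subringE[OF S] by auto
  show "u j = (\<Oplus>l\<in>J. (if j = l then \<one> else \<zero>) \<otimes> u l)" if "j \<in> J" for j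
  proof -
    have "(\<Oplus>l\<in>J. (if j = l then \<one> else \<zero>) \<otimes> u l) = (\<Oplus>l\<in>J. if j = l then u l else \<zero>)"
      using u by (intro finsum_cong') auto
    then show ?thesis using u that assms(2) finsum_singleton[of j J u] by auto
  qed
qed

text \<open>An arbitrary null vector \<open>u\<close> of \<open>x X1 - X2\<close> is a combination of null vectors with entries in \<open>L[x]\<close>,
because the pencil itself has entries in \<open>L[x]\<close>. If \<open>x\<close> were transcendental, all of these would be
annihilated by \<open>l X1\<close>, and so would \<open>u\<close>. In terms of derivatives: differentiating
\<open>(t X1 - X2) u(t) = 0\<close> at \<open>x\<close> and multiplying by \<open>l\<close> gives \<open>l X1 u = 0\<close>; the coefficient recursion
replaces this in characteristic \<open>p\<close>.\<close>

lemma (in field) pencil_root_algebraic: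
  fixes N :: nat
  assumes L: "subring L R" and x: "x \<in> carrier R"
    and X: "\<And>i j. i < N \<Longrightarrow> j < N \<Longrightarrow> X1 i j \<in> L" "\<And>i j. i < N \<Longrightarrow> j < N \<Longrightarrow> X2 i j \<in> L"
    and l: "\<And>i. i < N \<Longrightarrow> l i \<in> carrier R" and u: "\<And>j. j < N \<Longrightarrow> u j \<in> carrier R"
    and right: "\<And>i. i < N \<Longrightarrow> x \<otimes> (\<Oplus>j\<in>{..<N}. X1 i j \<otimes> u j) = (\<Oplus>j\<in>{..<N}. X2 i j \<otimes> u j)"
    and left: "\<And>j. j < N \<Longrightarrow> (\<Oplus>i\<in>{..<N}. l i \<otimes> X2 i j) = x \<otimes> (\<Oplus>i\<in>{..<N}. l i \<otimes> X1 i j)"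
    and nz: "(\<Oplus>i\<in>{..<N}. l i \<otimes> (\<Oplus>j\<in>{..<N}. X1 i j \<otimes> u j)) \<noteq> \<zero>"
  shows "(algebraic over L) x"
proof (rule ccontr)
  assume trans: "\<not> (algebraic over L) x"
  note LE = subringE[OF L]
  let ?S = "simple_extension L x"
  have S: "subring ?S R" by (rule simple_extension_is_subring[OF L x])
  have LS: "L \<subseteq> ?S" by (rule simple_extension_incl[OF LE(1) x])
  have xS: "x \<in> ?S" by (rule simple_extension_mem[OF L x])
  note SE = subringE[OF S]
  have Xc: "X1 i j \<in> carrier R" "X2 i j \<in> carrier R" if "i < N" "j < N" for i j
    using X[OF that] LE(1) by auto
  obtain I :: "nat set" and b c where I: "finite I" and b: "\<forall>m\<in>I. b m \<in> carrier R"
    and c: "\<forall>j\<in>{..<N}. \<forall>m\<in>I. c j m \<in> ?S" and uc: "\<forall>j\<in>{..<N}. u j = (\<Oplus>m\<in>I. c j m \<otimes> b m)"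
    and ind: "\<forall>d. d \<in> I \<rightarrow> ?S \<longrightarrow> (\<Oplus>m\<in>I. d m \<otimes> b m) = \<zero> \<longrightarrow> (\<forall>m\<in>I. d m = \<zero>)"
    using independent_expansion[OF S finite_lessThan, of N u] u by blast
  have cc: "c j m \<in> carrier R" if "j < N" "m \<in> I" for j m using c that SE(1) by auto
  have expand: "(\<Oplus>j\<in>{..<N}. Y j \<otimes> u j) = (\<Oplus>m\<in>I. (\<Oplus>j\<in>{..<N}. Y j \<otimes> c j m) \<otimes> b m)"
    if Y: "\<And>j. j < N \<Longrightarrow> Y j \<in> carrier R" for Y
  proof -
    have "(\<Oplus>j\<in>{..<N}. Y j \<otimes> u j) = (\<Oplus>j\<in>{..<N}. Y j \<otimes> (\<Oplus>m\<in>I. c j m \<otimes> b m))"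
      using uc cc b Y by (intro finsum_cong') (auto intro!: finsum_closed)
    also have "\<dots> = (\<Oplus>m\<in>I. (\<Oplus>j\<in>{..<N}. Y j \<otimes> c j m) \<otimes> b m)"
      using Y cc b I by (intro finsum_mult_assoc) auto
    finally show ?thesis .
  qed
  define A where "A = (\<lambda>i m. \<Oplus>j\<in>{..<N}. X1 i j \<otimes> c j m)"
  define B where "B = (\<lambda>i m. \<Oplus>j\<in>{..<N}. X2 i j \<otimes> c j m)"
  have AS: "A i m \<in> ?S" and BS: "B i m \<in> ?S" if "i < N" "m \<in> I" for i m
    unfolding A_def B_def using X that c LS
    by (auto intro!: finsum_in_subring[OF S] SE(6) intro: subsetD[OF LS])
  have Ac: "A i m \<in> carrier R" and Bc: "B i m \<in> carrier R" if "i < N" "m \<in> I" for i m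
    using AS[OF that] BS[OF that] SE(1) by auto
  have AB: "x \<otimes> A i m = B i m" if i: "i < N" and m: "m \<in> I" for i m
  proof -
    let ?d = "\<lambda>m. x \<otimes> A i m \<oplus> (\<ominus> \<one>) \<otimes> B i m"
    have "(\<Oplus>m\<in>I. ?d m \<otimes> b m) = (\<Oplus>m\<in>I. x \<otimes> (A i m \<otimes> b m) \<oplus> (\<ominus> \<one>) \<otimes> (B i m \<otimes> b m))"
      using Ac[OF i] Bc[OF i] b x by (intro finsum_cong') (auto simp: l_distr m_assoc)
    also have "\<dots> = (\<Oplus>m\<in>I. x \<otimes> (A i m \<otimes> b m)) \<oplus> (\<Oplus>m\<in>I. (\<ominus> \<one>) \<otimes> (B i m \<otimes> b m))"
      using Ac[OF i] Bc[OF i] b x by (intro finsum_addf) auto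
    also have "(\<Oplus>m\<in>I. x \<otimes> (A i m \<otimes> b m)) = x \<otimes> (\<Oplus>m\<in>I. A i m \<otimes> b m)"
      using Ac[OF i] b x I by (intro finsum_rdistr[symmetric]) auto
    also have "(\<Oplus>m\<in>I. (\<ominus> \<one>) \<otimes> (B i m \<otimes> b m)) = (\<ominus> \<one>) \<otimes> (\<Oplus>m\<in>I. B i m \<otimes> b m)"
      using Bc[OF i] b x I by (intro finsum_rdistr[symmetric]) auto
    also have "x \<otimes> (\<Oplus>m\<in>I. A i m \<otimes> b m) = (\<Oplus>m\<in>I. B i m \<otimes> b m)"
      using right[OF i] expand[of "X1 i"] expand[of "X2 i"] Xc[OF i] by (simp add: A_def B_def)
    finally have "(\<Oplus>m\<in>I. ?d m \<otimes> b m) = \<zero>"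
      using Bc[OF i] b by (simp add: l_minus finsum_closed r_neg Pi_def)
    moreover have "?d \<in> I \<rightarrow> ?S" using AS[OF i] BS[OF i] xS SE by auto
    ultimately have "?d m = \<zero>" using ind m by blast
    then have "x \<otimes> A i m \<ominus> B i m = \<zero>" using Bc[OF i m] by (simp add: l_minus a_minus_def)
    then show ?thesis using Ac[OF i m] Bc[OF i m] x by simp
  qed
  have lA: "(\<Oplus>i\<in>{..<N}. l i \<otimes> A i m) = \<zero>" if m: "m \<in> I" for m
    unfolding A_def
    using c m AB[OF _ m] by (intro kernel_vector_annihilated[OF L x trans X l _ _ left]) (auto simp: A_def B_def)
  have "(\<Oplus>i\<in>{..<N}. l i \<otimes> (\<Oplus>j\<in>{..<N}. X1 i j \<otimes> u j)) = (\<Oplus>i\<in>{..<N}. l i \<otimes> (\<Oplus>m\<in>I. A i m \<otimes> b m))"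
    using l Ac b Xc expand by (intro finsum_cong') (auto simp: A_def intro!: finsum_closed)
  also have "\<dots> = (\<Oplus>m\<in>I. (\<Oplus>i\<in>{..<N}. l i \<otimes> A i m) \<otimes> b m)"
    using l Ac b I by (intro finsum_mult_assoc) auto
  also have "\<dots> = \<zero>" using lA b by (auto intro!: add.finprod_one_eqI)
  finally show False using nz by simp
qed

section \<open>Matrices and the essential dimension of a representation\<close>

lemma square_matrices_carrier_iff:
  "A \<in> carrier (square_matrices n R) \<longleftrightarrow> A \<in> carrier_mat n n \<and> (\<forall>i<n. \<forall>j<n. A $$ (i, j) \<in> carrier R)"
  by (auto simp: square_matrices_def elements_mat_def UN_subset_iff image_subset_iff)

lemma square_matrices_one_index:
  "i < n \<Longrightarrow> j < n \<Longrightarrow> \<one>\<^bsub>square_matrices n R\<^esub> $$ (i, j) = (if i = j then \<one>\<^bsub>R\<^esub> else \<zero>\<^bsub>R\<^esub>)"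
  by (simp add: square_matrices_def)

lemma square_matrices_mult_index:
  "i < n \<Longrightarrow> j < n \<Longrightarrow>
    (A \<otimes>\<^bsub>square_matrices n R\<^esub> B) $$ (i, j) = (\<Oplus>\<^bsub>R\<^esub>l\<in>{..<n}. A $$ (i, l) \<otimes>\<^bsub>R\<^esub> B $$ (l, j))"
  by (simp add: square_matrices_def)

lemma square_matrices_eqI:
  assumes "A \<in> carrier (square_matrices n R)" "B \<in> carrier (square_matrices n R)"
    and "\<And>i j. i < n \<Longrightarrow> j < n \<Longrightarrow> A $$ (i, j) = B $$ (i, j)"
  shows "A = B"
  using assms by (intro eq_matI) (auto simp: square_matrices_carrier_iff)

lemma (in ring) monoid_square_matrices: "monoid (square_matrices n R)"
proof (rule monoidI)
  let ?M = "square_matrices n R"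
  have dim: "A \<otimes>\<^bsub>?M\<^esub> B \<in> carrier_mat n n" for A B by (simp add: square_matrices_def)
  have one: "\<one>\<^bsub>?M\<^esub> \<in> carrier_mat n n" by (simp add: square_matrices_def)
  show mult: "A \<otimes>\<^bsub>?M\<^esub> B \<in> carrier ?M" if "A \<in> carrier ?M" "B \<in> carrier ?M" for A B
    using that dim[of A B]
    by (auto simp: square_matrices_carrier_iff square_matrices_mult_index intro!: finsum_closed)
  show 1: "\<one>\<^bsub>?M\<^esub> \<in> carrier ?M"
    using one by (auto simp: square_matrices_carrier_iff square_matrices_one_index)
  show "A \<otimes>\<^bsub>?M\<^esub> B \<otimes>\<^bsub>?M\<^esub> C = A \<otimes>\<^bsub>?M\<^esub> (B \<otimes>\<^bsub>?M\<^esub> C)"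
    if A: "A \<in> carrier ?M" and B: "B \<in> carrier ?M" and C: "C \<in> carrier ?M" for A B C
  proof (rule square_matrices_eqI[OF mult[OF mult[OF A B] C] mult[OF A mult[OF B C]]])
    fix i j assume ij: "i < n" "j < n"
    have "(A \<otimes>\<^bsub>?M\<^esub> (B \<otimes>\<^bsub>?M\<^esub> C)) $$ (i, j) = (\<Oplus>l\<in>{..<n}. A $$ (i, l) \<otimes> (\<Oplus>m\<in>{..<n}. B $$ (l, m) \<otimes> C $$ (m, j)))"
      using ij A B C by (subst square_matrices_mult_index; simp?; intro finsum_cong')
        (auto simp: square_matrices_mult_index square_matrices_carrier_iff intro!: finsum_closed)
    also have "\<dots> = (\<Oplus>m\<in>{..<n}. (\<Oplus>l\<in>{..<n}. A $$ (i, l) \<otimes> B $$ (l, m)) \<otimes> C $$ (m, j))"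
      using ij A B C by (intro finsum_mult_assoc) (auto simp: square_matrices_carrier_iff)
    also have "\<dots> = (A \<otimes>\<^bsub>?M\<^esub> B \<otimes>\<^bsub>?M\<^esub> C) $$ (i, j)"
      using ij A B C by (subst square_matrices_mult_index[where A = "A \<otimes>\<^bsub>?M\<^esub> B"]; simp?; intro finsum_cong')
        (auto simp: square_matrices_mult_index square_matrices_carrier_iff intro!: finsum_closed)
    finally show "(A \<otimes>\<^bsub>?M\<^esub> B \<otimes>\<^bsub>?M\<^esub> C) $$ (i, j) = (A \<otimes>\<^bsub>?M\<^esub> (B \<otimes>\<^bsub>?M\<^esub> C)) $$ (i, j)" by simp
  qed
  show "\<one>\<^bsub>?M\<^esub> \<otimes>\<^bsub>?M\<^esub> A = A" if A: "A \<in> carrier ?M" for A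
  proof (rule square_matrices_eqI[OF mult[OF 1 A] A])
    fix i j assume ij: "i < n" "j < n"
    have "(\<one>\<^bsub>?M\<^esub> \<otimes>\<^bsub>?M\<^esub> A) $$ (i, j) = (\<Oplus>l\<in>{..<n}. if i = l then A $$ (l, j) else \<zero>)"
      using ij A by (subst square_matrices_mult_index; simp?; intro finsum_cong')
        (auto simp: square_matrices_one_index square_matrices_carrier_iff)
    then show "(\<one>\<^bsub>?M\<^esub> \<otimes>\<^bsub>?M\<^esub> A) $$ (i, j) = A $$ (i, j)"
      using ij A by (simp add: finsum_singleton square_matrices_carrier_iff)
  qed
  show "A \<otimes>\<^bsub>?M\<^esub> \<one>\<^bsub>?M\<^esub> = A" if A: "A \<in> carrier ?M" for A
  proof (rule square_matrices_eqI[OF mult[OF A 1] A])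
    fix i j assume ij: "i < n" "j < n"
    have "(A \<otimes>\<^bsub>?M\<^esub> \<one>\<^bsub>?M\<^esub>) $$ (i, j) = (\<Oplus>l\<in>{..<n}. if j = l then A $$ (i, l) else \<zero>)"
      using ij A by (subst square_matrices_mult_index; simp?; intro finsum_cong')
        (auto simp: square_matrices_one_index square_matrices_carrier_iff)
    then show "(A \<otimes>\<^bsub>?M\<^esub> \<one>\<^bsub>?M\<^esub>) $$ (i, j) = A $$ (i, j)"
      using ij A by (simp add: finsum_singleton square_matrices_carrier_iff)
  qed
qed

text \<open>The hypotheses on the rows \<open>p i\<close> and the columns \<open>q i\<close> are the coordinates' view of a two-dimensional
direct summand: \<open>h1 - 1\<close> and \<open>h2 - 1\<close> map the basis vector \<open>q i\<close> to \<open>1\<close> and \<open>a i\<close> times the basis vector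
\<open>p i\<close>, and no other basis vector contributes to coordinate \<open>p i\<close>. If \<open>\<sigma> = P \<rho> P\<^sup>-\<^sup>1\<close> is defined over
\<open>K0\<close>, then column \<open>q i\<close> of \<open>P\<close> and row \<open>p i\<close> of \<open>P\<^sup>-\<^sup>1\<close> are null vectors of the pencil
\<open>t (\<sigma>(h1) - 1) - (\<sigma>(h2) - 1)\<close> at \<open>t = a i\<close>.\<close>

lemma (in field) ed_rep_ge:
  fixes d :: nat and N :: nat
  assumes F: "subring F R"
    and \<rho>: "\<rho> \<in> hom G (GL N R)" and h: "h1 \<in> carrier G" "h2 \<in> carrier G"
    and a: "\<And>i. i < d \<Longrightarrow> a i \<in> carrier R" "\<And>i. i < d \<Longrightarrow> a i \<notin> algebraic_span (F \<union> a ` {..<i})"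
    and pq: "\<And>i. i < d \<Longrightarrow> p i < N \<and> q i < N \<and> p i \<noteq> q i"
    and row1: "\<And>i j. i < d \<Longrightarrow> j < N \<Longrightarrow>
       \<rho> h1 $$ (p i, j) = (if j = p i then \<one> else if j = q i then \<one> else \<zero>)"
    and col1: "\<And>i j. i < d \<Longrightarrow> j < N \<Longrightarrow>
       \<rho> h1 $$ (j, q i) = (if j = q i then \<one> else if j = p i then \<one> else \<zero>)"
    and row2: "\<And>i j. i < d \<Longrightarrow> j < N \<Longrightarrow>
       \<rho> h2 $$ (p i, j) = (if j = p i then \<one> else if j = q i then a i else \<zero>)"
    and col2: "\<And>i j. i < d \<Longrightarrow> j < N \<Longrightarrow>
       \<rho> h2 $$ (j, q i) = (if j = q i then \<one> else if j = p i then a i else \<zero>)"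
  shows "enat d \<le> ed_rep R F N G \<rho>"
  unfolding ed_rep_def
proof (rule Inf_greatest, clarify)
  let ?M = "square_matrices N R"
  interpret M: monoid ?M by (rule monoid_square_matrices)
  fix K0 \<sigma>
  assume K0: "subfield K0 R" "F \<subseteq> K0" and \<sigma>: "\<sigma> \<in> hom G (GL N (R\<lparr>carrier := K0\<rparr>))"
    and eqv: "equivalent_reps R N G \<rho> \<sigma>"
  note K = subringE[OF subfieldE(1)[OF K0(1)]]
  obtain P where P: "P \<in> Units ?M"
    and conj: "\<And>g. g \<in> carrier G \<Longrightarrow> \<sigma> g = P \<otimes>\<^bsub>?M\<^esub> \<rho> g \<otimes>\<^bsub>?M\<^esub> inv\<^bsub>?M\<^esub> P"
    using eqv M.units_of_inv by (auto simp: equivalent_reps_def GL_def units_of_carrier units_of_mult)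
  define Q where "Q = inv\<^bsub>?M\<^esub> P"
  have PM: "P \<in> carrier ?M" "Q \<in> carrier ?M" using P by (auto simp: Q_def)
  have QP: "Q \<otimes>\<^bsub>?M\<^esub> P = \<one>\<^bsub>?M\<^esub>" using P by (simp add: Q_def)
  have \<rho>M: "\<rho> g \<in> carrier ?M" if "g \<in> carrier G" for g
    using hom_in_carrier[OF \<rho> that] by (auto simp: GL_def units_of_carrier)
  have \<sigma>K: "\<sigma> g $$ (i, j) \<in> K0" if "g \<in> carrier G" "i < N" "j < N" for g i j
  proof -
    have "\<sigma> g \<in> carrier (square_matrices N (R\<lparr>carrier := K0\<rparr>))"
      using hom_in_carrier[OF \<sigma> that(1)] by (auto simp: GL_def units_of_carrier Units_def)
    then show ?thesis using that by (simp add: square_matrices_carrier_iff)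
  qed
  have \<sigma>c: "\<sigma> g $$ (i, j) \<in> carrier R" if "g \<in> carrier G" "i < N" "j < N" for g i j
    using \<sigma>K[OF that] K(1) by auto
  have sP: "\<sigma> g \<otimes>\<^bsub>?M\<^esub> P = P \<otimes>\<^bsub>?M\<^esub> \<rho> g" if "g \<in> carrier G" for g
    using conj[OF that] PM QP \<rho>M[OF that] by (simp add: M.m_assoc Q_def[symmetric])
  have Qs: "Q \<otimes>\<^bsub>?M\<^esub> \<sigma> g = \<rho> g \<otimes>\<^bsub>?M\<^esub> Q" if "g \<in> carrier G" for g
    using conj[OF that] PM QP \<rho>M[OF that] by (simp add: M.m_assoc[symmetric] Q_def[symmetric])
  have Pc: "P $$ (i, j) \<in> carrier R" and Qc: "Q $$ (i, j) \<in> carrier R" if "i < N" "j < N" for i j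
    using PM that by (auto simp: square_matrices_carrier_iff)
  have \<rho>c: "\<rho> g $$ (i, j) \<in> carrier R" if "g \<in> carrier G" "i < N" "j < N" for g i j
    using \<rho>M[OF that(1)] that by (auto simp: square_matrices_carrier_iff)
  (* Y g is the matrix of g - 1 *)
  define Y where "Y = (\<lambda>g i j. \<sigma> g $$ (i, j) \<oplus> (if i = j then \<ominus> \<one> else \<zero>))"
  have YK: "Y g i j \<in> K0" if "g \<in> carrier G" "i < N" "j < N" for g i j
    using \<sigma>K[OF that] K by (auto simp: Y_def)
  have cancel: "x \<oplus> y \<oplus> \<ominus> x = y" if "x \<in> carrier R" "y \<in> carrier R" for x y
    using that by algebra
  show "enat d \<le> trdeg R F K0"
  proof (rule trdeg_ge[where a = a, OF F K0(2) K(1)])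
    show "a i \<notin> algebraic_span (F \<union> a ` {..<i})" if "i < d" for i
      using a(2)[OF that] .
    fix i assume i: "i < d"
    define p' q' where "p' = p i" and "q' = q i"
    have pq': "p' < N" "q' < N" "p' \<noteq> q'" using pq[OF i] by (auto simp: p'_def q'_def)
    have right: "(\<Oplus>j\<in>{..<N}. Y g m j \<otimes> P $$ (j, q')) = P $$ (m, p') \<otimes> c"
      if g: "g \<in> carrier G" and c: "c \<in> carrier R" and m: "m < N"
        and col: "\<And>j. j < N \<Longrightarrow> \<rho> g $$ (j, q') = (if j = q' then \<one> else if j = p' then c else \<zero>)"
      for g c m
    proof -
      have "(\<Oplus>j\<in>{..<N}. Y g m j \<otimes> P $$ (j, q'))
          = (\<Oplus>j\<in>{..<N}. \<sigma> g $$ (m, j) \<otimes> P $$ (j, q') \<oplus> (if m = j then \<ominus> P $$ (j, q') else \<zero>))"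
        using \<sigma>c[OF g m] Pc pq' by (intro finsum_cong') (auto simp: Y_def l_distr l_minus)
      also have "\<dots> = (\<Oplus>j\<in>{..<N}. \<sigma> g $$ (m, j) \<otimes> P $$ (j, q'))
          \<oplus> (\<Oplus>j\<in>{..<N}. if m = j then \<ominus> P $$ (j, q') else \<zero>)"
        using \<sigma>c[OF g m] Pc pq' by (intro finsum_addf) auto
      also have "(\<Oplus>j\<in>{..<N}. if m = j then \<ominus> P $$ (j, q') else \<zero>) = \<ominus> P $$ (m, q')"
        using Pc pq' m by (subst finsum_singleton) auto
      also have "(\<Oplus>j\<in>{..<N}. \<sigma> g $$ (m, j) \<otimes> P $$ (j, q')) = (P \<otimes>\<^bsub>?M\<^esub> \<rho> g) $$ (m, q')"
        using sP[OF g] m pq' by (simp add: square_matrices_mult_index[symmetric])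
      also have "\<dots> = (\<Oplus>j\<in>{..<N}. P $$ (m, j) \<otimes> \<rho> g $$ (j, q'))"
        using m pq' by (simp add: square_matrices_mult_index)
      also have "\<dots> = P $$ (m, q') \<otimes> \<rho> g $$ (q', q') \<oplus> P $$ (m, p') \<otimes> \<rho> g $$ (p', q')"
        using Pc[OF m] pq' c by (intro finsum_two) (auto simp: col)
      also have "\<dots> = P $$ (m, q') \<oplus> P $$ (m, p') \<otimes> c"
        using Pc[OF m] pq' c by (simp add: col)
      finally show ?thesis using cancel Pc[OF m] pq' c by simp
    qed
    have left: "(\<Oplus>m\<in>{..<N}. Q $$ (p', m) \<otimes> Y g m j) = c \<otimes> Q $$ (q', j)"
      if g: "g \<in> carrier G" and c: "c \<in> carrier R" and j: "j < N"
        and row: "\<And>j. j < N \<Longrightarrow> \<rho> g $$ (p', j) = (if j = p' then \<one> else if j = q' then c else \<zero>)"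
      for g c j
    proof -
      have "(\<Oplus>m\<in>{..<N}. Q $$ (p', m) \<otimes> Y g m j)
          = (\<Oplus>m\<in>{..<N}. Q $$ (p', m) \<otimes> \<sigma> g $$ (m, j) \<oplus> (if j = m then \<ominus> Q $$ (p', m) else \<zero>))"
        using \<sigma>c[OF g _ j] Qc pq' by (intro finsum_cong') (auto simp: Y_def r_distr r_minus)
      also have "\<dots> = (\<Oplus>m\<in>{..<N}. Q $$ (p', m) \<otimes> \<sigma> g $$ (m, j))
          \<oplus> (\<Oplus>m\<in>{..<N}. if j = m then \<ominus> Q $$ (p', m) else \<zero>)"
        using \<sigma>c[OF g _ j] Qc pq' by (intro finsum_addf) auto
      also have "(\<Oplus>m\<in>{..<N}. if j = m then \<ominus> Q $$ (p', m) else \<zero>) = \<ominus> Q $$ (p', j)"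
        using Qc pq' j by (subst finsum_singleton) auto
      also have "(\<Oplus>m\<in>{..<N}. Q $$ (p', m) \<otimes> \<sigma> g $$ (m, j)) = (\<rho> g \<otimes>\<^bsub>?M\<^esub> Q) $$ (p', j)"
        using Qs[OF g] j pq' by (simp add: square_matrices_mult_index[symmetric])
      also have "\<dots> = (\<Oplus>m\<in>{..<N}. \<rho> g $$ (p', m) \<otimes> Q $$ (m, j))"
        using j pq' by (simp add: square_matrices_mult_index)
      also have "\<dots> = \<rho> g $$ (p', p') \<otimes> Q $$ (p', j) \<oplus> \<rho> g $$ (p', q') \<otimes> Q $$ (q', j)"
        using Qc[OF _ j] pq' c by (intro finsum_two) (auto simp: row)
      also have "\<dots> = Q $$ (p', j) \<oplus> c \<otimes> Q $$ (q', j)"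
        using Qc[OF _ j] pq' c by (simp add: row)
      finally show ?thesis using cancel Qc[OF _ j] pq' c by simp
    qed
    have r1: "(\<Oplus>j\<in>{..<N}. Y h1 m j \<otimes> P $$ (j, q')) = P $$ (m, p')" if "m < N" for m
      using right[OF h(1) one_closed that] col1[OF i] Pc[OF that] pq' by (simp add: p'_def q'_def)
    have r2: "(\<Oplus>j\<in>{..<N}. Y h2 m j \<otimes> P $$ (j, q')) = P $$ (m, p') \<otimes> a i" if "m < N" for m
      using right[OF h(2) a(1)[OF i] that] col2[OF i] by (simp add: p'_def q'_def)
    have l1: "(\<Oplus>m\<in>{..<N}. Q $$ (p', m) \<otimes> Y h1 m j) = Q $$ (q', j)" if "j < N" for j
      using left[OF h(1) one_closed that] row1[OF i] Qc[OF _ that] pq' by (simp add: p'_def q'_def)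
    have l2: "(\<Oplus>m\<in>{..<N}. Q $$ (p', m) \<otimes> Y h2 m j) = a i \<otimes> Q $$ (q', j)" if "j < N" for j
      using left[OF h(2) a(1)[OF i] that] row2[OF i] by (simp add: p'_def q'_def)
    have "(\<Oplus>m\<in>{..<N}. Q $$ (p', m) \<otimes> (\<Oplus>j\<in>{..<N}. Y h1 m j \<otimes> P $$ (j, q')))
        = (\<Oplus>m\<in>{..<N}. Q $$ (p', m) \<otimes> P $$ (m, p'))"
      using r1 Qc Pc pq' by (intro finsum_cong') auto
    also have "\<dots> = \<one>"
      using QP pq' by (simp add: square_matrices_mult_index[symmetric] square_matrices_one_index)
    finally have nz: "(\<Oplus>m\<in>{..<N}. Q $$ (p', m) \<otimes> (\<Oplus>j\<in>{..<N}. Y h1 m j \<otimes> P $$ (j, q'))) \<noteq> \<zero>"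
      by simp
    have "(algebraic over K0) (a i)"
    proof (rule pencil_root_algebraic[where ?X1.0 = "Y h1" and ?X2.0 = "Y h2" and N = N
          and l = "\<lambda>m. Q $$ (p', m)" and u = "\<lambda>m. P $$ (m, q')", OF subfieldE(1)[OF K0(1)] a(1)[OF i] _ _ _ _ _ _ nz])
      show "Y h1 m j \<in> K0" "Y h2 m j \<in> K0" if "m < N" "j < N" for m j
        using YK h that by auto
      show "Q $$ (p', m) \<in> carrier R" if "m < N" for m using Qc pq' that by auto
      show "P $$ (m, q') \<in> carrier R" if "m < N" for m using Pc pq' that by auto
      show "a i \<otimes> (\<Oplus>j\<in>{..<N}. Y h1 m j \<otimes> P $$ (j, q')) = (\<Oplus>j\<in>{..<N}. Y h2 m j \<otimes> P $$ (j, q'))"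
        if "m < N" for m
        using that r1 r2 Pc pq' a(1)[OF i] by (simp add: m_comm)
      show "(\<Oplus>m\<in>{..<N}. Q $$ (p', m) \<otimes> Y h2 m j) = a i \<otimes> (\<Oplus>m\<in>{..<N}. Q $$ (p', m) \<otimes> Y h1 m j)"
        if "j < N" for j
        using that l1 l2 by simp
    qed
    then show "a i \<in> algebraic_span K0"
      using a(1)[OF i] K0(1) by (simp add: algebraic_span_def)
  qed
qed

section \<open>Function fields inside a large universe\<close>

context
  includes cardinal_syntax
begin

lemma lepoll_iff_ordLeq: "A \<lesssim> B \<longleftrightarrow> |A| \<le>o |B|"
  by (simp add: lepoll_def card_of_ordLeq)

lemma infinite_times_lepoll:
  assumes "infinite B" "A \<lesssim> B" "C \<lesssim> B"
  shows "A \<times> C \<lesssim> B"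
  using assms by (simp add: lepoll_iff_ordLeq card_of_Sigma_ordLeq_infinite)

lemma infinite_lists_lepoll:
  assumes "infinite B"
  shows "lists B \<lesssim> B"
proof -
  have "{xs \<in> lists B. length xs = n} \<lesssim> B" for n
  proof (induction n)
    case 0
    have "{xs \<in> lists B. length xs = 0} = {[]}" by auto
    then show ?case using assms by (simp add: finite_lepoll_infinite)
  next
    case (Suc n)
    have "{xs \<in> lists B. length xs = Suc n} = (\<lambda>(x, xs). x # xs) ` (B \<times> {xs \<in> lists B. length xs = n})"
      by (auto simp: length_Suc_conv image_iff)
    then have "{xs \<in> lists B. length xs = Suc n} \<lesssim> B \<times> {xs \<in> lists B. length xs = n}"
      by (simp add: image_lepoll)
    also have "\<dots> \<lesssim> B" by (rule infinite_times_lepoll[OF assms lepoll_refl Suc])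
    finally show ?case .
  qed
  then have "|\<Union>n. {xs \<in> lists B. length xs = n}| \<le>o |B|"
    using assms by (intro card_of_UNION_ordLeq_infinite)
      (auto simp: lepoll_iff_ordLeq infinite_iff_card_of_nat)
  moreover have "(\<Union>n. {xs \<in> lists B. length xs = n}) = lists B" by auto
  ultimately show ?thesis by (simp add: lepoll_iff_ordLeq)
qed

end

text \<open>A quotient of a set that injects into a type can be realised inside that type, by choosing a
representative of every class.\<close>

lemma ex_quotient_map:
  assumes "A \<lesssim> (UNIV :: 'b set)" "equiv A r"
  obtains q :: "'a \<Rightarrow> 'b" where "\<And>x y. x \<in> A \<Longrightarrow> y \<in> A \<Longrightarrow> q x = q y \<longleftrightarrow> (x, y) \<in> r"
proof -
  obtain h :: "'a \<Rightarrow> 'b" where h: "inj_on h A" using assms(1) by (auto simp: lepoll_def)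
  define rep where "rep = (\<lambda>x. SOME z. z \<in> r `` {x})"
  have rep: "(x, rep x) \<in> r" if "x \<in> A" for x
  proof -
    have "x \<in> r `` {x}" using assms(2) that by (rule equiv_class_self)
    then have "rep x \<in> r `` {x}" unfolding rep_def by (rule someI)
    then show ?thesis by simp
  qed
  have sym: "(y, x) \<in> r" if "(x, y) \<in> r" for x y
    using assms(2) that unfolding equiv_def by (blast dest: symD)
  have trans: "(x, z) \<in> r" if "(x, y) \<in> r" "(y, z) \<in> r" for x y z
    using assms(2) that unfolding equiv_def by (blast dest: transD)
  have repA: "rep x \<in> A" if "x \<in> A" for x
    using rep[OF that] equiv_type[OF assms(2)] by auto
  show thesis
  proof (rule that)
    fix x y assume xy: "x \<in> A" "y \<in> A"
    have "rep x = rep y \<longleftrightarrow> (x, y) \<in> r"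
    proof
      assume "rep x = rep y"
      then show "(x, y) \<in> r" using trans[OF rep[OF xy(1)]] sym[OF rep[OF xy(2)]] by simp
    next
      assume "(x, y) \<in> r"
      then have "r `` {x} = r `` {y}" by (rule equiv_class_eq[OF assms(2)])
      then show "rep x = rep y" by (simp only: rep_def)
    qed
    then show "h (rep x) = h (rep y) \<longleftrightarrow> (x, y) \<in> r"
      using inj_on_eq_iff[OF h repA repA] xy by simp
  qed
qed

text \<open>The fraction field of a domain, built directly inside a prescribed infinite type: \<open>q\<close> identifies
two fractions exactly when they are equal, and every field axiom reduces to an identity between
cross products.\<close>

lemma (in domain) ex_field_of_fractions:
  assumes inf: "infinite (UNIV :: 'c set)" and small: "carrier R \<lesssim> (UNIV :: 'c set)"
  shows "\<exists>(L :: 'c ring) j. field L \<and> j \<in> Ring.ring_hom R L \<and> inj_on j (carrier R)"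
proof -
  define P where "P = carrier R \<times> (carrier R - {\<zero>})"
  define r where "r = {(x, y). x \<in> P \<and> y \<in> P \<and> fst x \<otimes> snd y = fst y \<otimes> snd x}"
  have P: "x \<in> P \<longleftrightarrow> fst x \<in> carrier R \<and> snd x \<in> carrier R \<and> snd x \<noteq> \<zero>" for x
    by (auto simp: P_def mem_Times_iff)
  have "equiv P r"
  proof (rule equivI)
    show "trans r"
    proof (rule transI)
      fix x y z assume xy: "(x, y) \<in> r" and yz: "(y, z) \<in> r"
      obtain a b c d e f where [simp]: "x = (a, b)" "y = (c, d)" "z = (e, f)" by (metis prod.exhaust)
      have R: "a \<in> carrier R" "b \<in> carrier R" "c \<in> carrier R" "d \<in> carrier R" "e \<in> carrier R" "f \<in> carrier R"
        "d \<noteq> \<zero>" and eqs: "a \<otimes> d = c \<otimes> b" "c \<otimes> f = e \<otimes> d"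
        using xy yz by (auto simp: r_def P)
      have "d \<otimes> (a \<otimes> f) = (a \<otimes> d) \<otimes> f" using R by algebra
      also have "\<dots> = b \<otimes> (c \<otimes> f)" unfolding eqs(1) using R by algebra
      also have "\<dots> = d \<otimes> (e \<otimes> b)" unfolding eqs(2) using R by algebra
      finally have "a \<otimes> f = e \<otimes> b" using R by (simp add: m_lcancel)
      then show "(x, z) \<in> r" using xy yz by (auto simp: r_def)
    qed
  qed (auto simp: r_def refl_on_def sym_def)
  moreover have "P \<lesssim> (UNIV :: 'c set)"
  proof -
    have "P \<lesssim> carrier R \<times> carrier R" unfolding P_def by (intro subset_imp_lepoll) auto
    then show ?thesis using infinite_times_lepoll[OF inf small small] lepoll_trans by blast
  qed
  ultimately obtain q :: "'a \<times> 'a \<Rightarrow> 'c"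
    where q: "\<And>x y. x \<in> P \<Longrightarrow> y \<in> P \<Longrightarrow> q x = q y \<longleftrightarrow> (x, y) \<in> r"
    using ex_quotient_map by blast
  have qI: "q (a, b) = q (c, d)" if "a \<otimes> d = c \<otimes> b" "a \<in> carrier R" "b \<in> carrier R" "b \<noteq> \<zero>"
     "c \<in> carrier R" "d \<in> carrier R" "d \<noteq> \<zero>" for a b c d
    using that by (subst q) (auto simp: P r_def)
  have qD: "a \<otimes> d = c \<otimes> b" if "q (a, b) = q (c, d)" "a \<in> carrier R" "b \<in> carrier R" "b \<noteq> \<zero>"
     "c \<in> carrier R" "d \<in> carrier R" "d \<noteq> \<zero>" for a b c d
    using that by (subst (asm) q) (auto simp: P r_def)
  define rep where "rep = inv_into P q"
  define tm where "tm = (\<lambda>x y. (fst x \<otimes> fst y, snd x \<otimes> snd y))"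
  define ad where "ad = (\<lambda>x y. (fst x \<otimes> snd y \<oplus> fst y \<otimes> snd x, snd x \<otimes> snd y))"
  define L where "L = \<lparr>carrier = q ` P, monoid.mult = (\<lambda>u v. q (tm (rep u) (rep v))), one = q (\<one>, \<one>),
     zero = q (\<zero>, \<one>), add = (\<lambda>u v. q (ad (rep u) (rep v)))\<rparr>"
  have rep: "rep (q x) \<in> P" "q (rep (q x)) = q x" if "x \<in> P" for x
    unfolding rep_def using that by (auto intro: inv_into_into f_inv_into_f)
  have nz: "b \<otimes> d \<noteq> \<zero>" if "b \<in> carrier R" "b \<noteq> \<zero>" "d \<in> carrier R" "d \<noteq> \<zero>" for b d
    using that integral_iff by auto
  have mult: "q (a, b) \<otimes>\<^bsub>L\<^esub> q (c, d) = q (a \<otimes> c, b \<otimes> d)"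
   and plus: "q (a, b) \<oplus>\<^bsub>L\<^esub> q (c, d) = q (a \<otimes> d \<oplus> c \<otimes> b, b \<otimes> d)"
    if ab: "a \<in> carrier R" "b \<in> carrier R" "b \<noteq> \<zero>" and cd: "c \<in> carrier R" "d \<in> carrier R" "d \<noteq> \<zero>"
    for a b c d
  proof -
    obtain a' b' where ab': "rep (q (a, b)) = (a', b')" by (cases "rep (q (a, b))")
    obtain c' d' where cd': "rep (q (c, d)) = (c', d')" by (cases "rep (q (c, d))")
    have A: "a' \<in> carrier R" "b' \<in> carrier R" "b' \<noteq> \<zero>" "q (a', b') = q (a, b)"
      using rep[of "(a, b)"] ab ab' by (auto simp: P)
    have C: "c' \<in> carrier R" "d' \<in> carrier R" "d' \<noteq> \<zero>" "q (c', d') = q (c, d)"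
      using rep[of "(c, d)"] cd cd' by (auto simp: P)
    have e1: "a' \<otimes> b = a \<otimes> b'" using qD[OF A(4)] A ab by auto
    have e2: "c' \<otimes> d = c \<otimes> d'" using qD[OF C(4)] C cd by auto
    have "(a' \<otimes> c') \<otimes> (b \<otimes> d) = (a' \<otimes> b) \<otimes> (c' \<otimes> d)" using A C ab cd by algebra
    also have "\<dots> = (a \<otimes> c) \<otimes> (b' \<otimes> d')" unfolding e1 e2 using A C ab cd by algebra
    finally show "q (a, b) \<otimes>\<^bsub>L\<^esub> q (c, d) = q (a \<otimes> c, b \<otimes> d)"
      using A C ab cd nz by (auto simp: L_def tm_def ab' cd' intro!: qI)
    have "(a' \<otimes> d' \<oplus> c' \<otimes> b') \<otimes> (b \<otimes> d) = (a' \<otimes> b) \<otimes> (d' \<otimes> d) \<oplus> (c' \<otimes> d) \<otimes> (b' \<otimes> b)"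
      using A C ab cd by algebra
    also have "\<dots> = (a \<otimes> d \<oplus> c \<otimes> b) \<otimes> (b' \<otimes> d')"
      unfolding e1 e2 using A C ab cd by algebra
    finally show "q (a, b) \<oplus>\<^bsub>L\<^esub> q (c, d) = q (a \<otimes> d \<oplus> c \<otimes> b, b \<otimes> d)"
      using A C ab cd nz by (auto simp: L_def ad_def ab' cd' intro!: qI)
  qed
  have carr: "u \<in> carrier L \<longleftrightarrow> (\<exists>a b. u = q (a, b) \<and> a \<in> carrier R \<and> b \<in> carrier R \<and> b \<noteq> \<zero>)" for u
    by (force simp: L_def P image_iff)
  have qc: "q (a, b) \<in> carrier L" if "a \<in> carrier R" "b \<in> carrier R" "b \<noteq> \<zero>" for a b
    unfolding carr using that by blast
  have oneL: "\<one>\<^bsub>L\<^esub> = q (\<one>, \<one>)" and zeroL: "\<zero>\<^bsub>L\<^esub> = q (\<zero>, \<one>)" by (simp_all add: L_def)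
  have "cring L"
  proof (rule cringI[OF abelian_groupI comm_monoidI])
    fix u v w assume "u \<in> carrier L" "v \<in> carrier L" "w \<in> carrier L"
    then obtain a b c d e f where uvw: "u = q (a, b)" "v = q (c, d)" "w = q (e, f)"
      and R: "a \<in> carrier R" "b \<in> carrier R" "b \<noteq> \<zero>" "c \<in> carrier R" "d \<in> carrier R" "d \<noteq> \<zero>"
        "e \<in> carrier R" "f \<in> carrier R" "f \<noteq> \<zero>"
      unfolding carr by blast
    show "u \<oplus>\<^bsub>L\<^esub> v \<oplus>\<^bsub>L\<^esub> w = u \<oplus>\<^bsub>L\<^esub> (v \<oplus>\<^bsub>L\<^esub> w)"
      unfolding uvw using R nz by (simp add: plus) (intro qI; (simp add: nz)?; algebra)
    show "u \<otimes>\<^bsub>L\<^esub> v \<otimes>\<^bsub>L\<^esub> w = u \<otimes>\<^bsub>L\<^esub> (v \<otimes>\<^bsub>L\<^esub> w)"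
      unfolding uvw using R nz by (simp add: mult m_assoc)
    show "(u \<oplus>\<^bsub>L\<^esub> v) \<otimes>\<^bsub>L\<^esub> w = u \<otimes>\<^bsub>L\<^esub> w \<oplus>\<^bsub>L\<^esub> v \<otimes>\<^bsub>L\<^esub> w"
      unfolding uvw using R nz by (simp add: plus mult) (intro qI; (simp add: nz)?; algebra)
  next
    fix u v assume "u \<in> carrier L" "v \<in> carrier L"
    then obtain a b c d where uv: "u = q (a, b)" "v = q (c, d)"
      and R: "a \<in> carrier R" "b \<in> carrier R" "b \<noteq> \<zero>" "c \<in> carrier R" "d \<in> carrier R" "d \<noteq> \<zero>"
      unfolding carr by blast
    show "u \<oplus>\<^bsub>L\<^esub> v \<in> carrier L" "u \<otimes>\<^bsub>L\<^esub> v \<in> carrier L"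
      unfolding uv carr using R nz by (auto simp: plus mult intro!: exI)
    show "u \<oplus>\<^bsub>L\<^esub> v = v \<oplus>\<^bsub>L\<^esub> u" "u \<otimes>\<^bsub>L\<^esub> v = v \<otimes>\<^bsub>L\<^esub> u"
      unfolding uv using R by (simp_all add: plus mult a_comm m_comm)
    show "\<zero>\<^bsub>L\<^esub> \<oplus>\<^bsub>L\<^esub> u = u" "\<one>\<^bsub>L\<^esub> \<otimes>\<^bsub>L\<^esub> u = u"
      unfolding uv oneL zeroL using R by (simp_all add: plus mult)
    have "q (\<ominus> a, b) \<oplus>\<^bsub>L\<^esub> u = \<zero>\<^bsub>L\<^esub>"
      unfolding uv zeroL using R nz by (simp add: plus) (intro qI; (simp add: nz)?; algebra)
    moreover have "q (\<ominus> a, b) \<in> carrier L" unfolding carr using R by blast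
    ultimately show "\<exists>y\<in>carrier L. y \<oplus>\<^bsub>L\<^esub> u = \<zero>\<^bsub>L\<^esub>" by blast
  next
    show "\<zero>\<^bsub>L\<^esub> \<in> carrier L" "\<one>\<^bsub>L\<^esub> \<in> carrier L"
      unfolding carr oneL zeroL using zero_closed one_closed one_not_zero by blast+
  qed
  then interpret L: cring L .
  have "field L"
  proof (rule L.cring_fieldI2)
    show "\<zero>\<^bsub>L\<^esub> \<noteq> \<one>\<^bsub>L\<^esub>" using qD[of \<zero> \<one> \<one> \<one>] by (auto simp: oneL zeroL)
    fix u assume "u \<in> carrier L" "u \<noteq> \<zero>\<^bsub>L\<^esub>"
    then obtain a b where u: "u = q (a, b)" "a \<in> carrier R" "b \<in> carrier R" "b \<noteq> \<zero>"
      unfolding carr by blast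
    have "a \<noteq> \<zero>" using \<open>u \<noteq> \<zero>\<^bsub>L\<^esub>\<close> u by (auto simp: zeroL intro!: qI)
    then have "u \<otimes>\<^bsub>L\<^esub> q (b, a) = \<one>\<^bsub>L\<^esub>"
      using u nz by (auto simp: mult oneL m_comm intro!: qI)
    moreover have "q (b, a) \<in> carrier L" unfolding carr using u \<open>a \<noteq> \<zero>\<close> by blast
    ultimately show "\<exists>v\<in>carrier L. u \<otimes>\<^bsub>L\<^esub> v = \<one>\<^bsub>L\<^esub>" by blast
  qed
  moreover have "(\<lambda>a. q (a, \<one>)) \<in> Ring.ring_hom R L"
    by (rule ring_hom_memI) (auto simp: qc mult plus oneL)
  moreover have "inj_on (\<lambda>a. q (a, \<one>)) (carrier R)"
    by (rule inj_onI) (use qD[of _ \<one> _ \<one>] in auto)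
  ultimately show ?thesis by blast
qed

text \<open>The field \<open>R(X)\<close>. The variable is transcendental because evaluating a polynomial at \<open>X\<close> returns the
polynomial itself.\<close>

lemma (in field) ex_transcendental_extension:
  assumes inf: "infinite (UNIV :: 'c set)" and small: "carrier R \<lesssim> (UNIV :: 'c set)"
  shows "\<exists>(L :: 'c ring) j t. field L \<and> j \<in> Ring.ring_hom R L \<and> t \<in> carrier L \<and>
    t \<notin> field.algebraic_span L (j ` carrier R)"
proof -
  let ?P = "(carrier R)[X]"
  interpret P: domain ?P by (rule univ_poly_is_domain[OF carrier_is_subring])
  have "carrier ?P \<subseteq> lists (carrier R)"
    by (auto simp: univ_poly_carrier[symmetric] polynomial_def)
  then have "carrier ?P \<lesssim> lists (carrier R)" by (rule subset_imp_lepoll)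
  also have "\<dots> \<lesssim> lists (UNIV :: 'c set)" by (rule lists_lepoll_mono[OF small])
  also have "\<dots> \<lesssim> (UNIV :: 'c set)" by (rule infinite_lists_lepoll[OF inf])
  finally obtain L :: "'c ring" and J where L: "field L" and J: "J \<in> Ring.ring_hom ?P L" "inj_on J (carrier ?P)"
    using P.ex_field_of_fractions[OF inf] by blast
  interpret L: field L by (rule L)
  interpret C: ring_hom_ring R ?P poly_of_const
    using canonical_embedding_ring_hom[OF carrier_is_subring] by simp
  interpret J: ring_hom_ring ?P L J by (rule ring_hom_ringI2[OF P.ring_axioms L.ring_axioms J(1)])
  define j where "j = J \<circ> poly_of_const"
  have j: "j \<in> Ring.ring_hom R L" unfolding j_def by (rule ring_hom_trans[OF C.homh J(1)])
  interpret j: ring_hom_ring R L j by (rule ring_hom_ringI2[OF ring_axioms L.ring_axioms j])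
  have sub: "subfield (j ` carrier R) L"
    by (rule j.img_is_subfield(2)[OF carrier_is_subfield]) auto
  have X: "X \<in> carrier ?P" by (rule var_closed(1)[OF carrier_is_subring])
  have "J X \<notin> L.algebraic_span (j ` carrier R)"
  proof
    assume "J X \<in> L.algebraic_span (j ` carrier R)"
    then have "(L.algebraic over (j ` carrier R)) (J X)"
      by (simp add: L.algebraic_span_def L.subfield_generate_field[OF sub])
    then obtain p' where p': "p' \<in> carrier ((j ` carrier R)[X]\<^bsub>L\<^esub>)" "p' \<noteq> []" "L.eval p' (J X) = \<zero>\<^bsub>L\<^esub>"
      using L.algebraicE[OF subfieldE(1)[OF sub], of "J X"] X by auto
    then have "set p' \<subseteq> j ` carrier R" and lc: "lead_coeff p' \<noteq> \<zero>\<^bsub>L\<^esub>"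
      by (auto simp: univ_poly_carrier[symmetric] polynomial_def)
    then have "p' \<in> map j ` lists (carrier R)" by (auto simp: lists_image[symmetric])
    then obtain p where p: "set p \<subseteq> carrier R" "p' = map j p" by auto
    have "p \<noteq> []" using p p' by auto
    then have "lead_coeff p \<noteq> \<zero>" using lc p(2) by (auto simp: hd_map)
    then have pP: "p \<in> carrier ?P" using p(1) by (simp add: univ_poly_carrier[symmetric] polynomial_def)
    have "J p = J (P.eval (map poly_of_const p) X)"
      using eval_rewrite[OF carrier_is_subring pP] by simp
    also have "\<dots> = L.eval (map J (map poly_of_const p)) (J X)"
      using p(1) X by (intro J.eval_hom') auto
    also have "\<dots> = J \<zero>\<^bsub>?P\<^esub>" using p'(3) p(2) by (simp add: j_def)
    finally have eq: "J p = J \<zero>\<^bsub>?P\<^esub>" .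
    have "p = \<zero>\<^bsub>?P\<^esub>" by (rule inj_onD[OF J(2) eq pP]) simp
    then show False using \<open>p \<noteq> []\<close> by (simp add: univ_poly_zero)
  qed
  then show ?thesis
    using L j X by (intro exI[of _ L] exI[of _ j] exI[of _ "J X"]) simp
qed

text \<open>Homomorphisms of fields are injective, so an algebraic equation over the image can be pulled back. This
keeps elements independent when the field is enlarged.\<close>

lemma algebraic_span_hom_reflect:
  assumes K: "field K" and L: "field L" and j: "j \<in> Ring.ring_hom K L"
    and A: "A \<subseteq> carrier K" and x: "x \<in> carrier K" "j x \<in> field.algebraic_span L (j ` A)"
  shows "x \<in> field.algebraic_span K A"
proof -
  interpret K: field K by fact
  interpret L: field L by fact
  interpret j: ring_hom_ring K L j by (rule ring_hom_ringI2[OF K.ring_axioms L.ring_axioms j])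
  interpret jc: ring_hom_cring K L j
    by (intro ring_hom_cring.intro ring_hom_cring_axioms.intro j K.is_cring L.is_cring)
  let ?F = "generate_field K A"
  have F: "subfield ?F K" by (rule K.generate_field_is_subfield[OF A])
  note FE = subringE[OF subfieldE(1)[OF F]]
  have jF: "subfield (j ` ?F) L" by (rule j.img_is_subfield(2)[OF F]) auto
  have jinj: "inj_on j (carrier K)"
    by (rule j.img_is_subfield(1)[OF K.carrier_is_subfield]) auto
  have "generate_field L (j ` A) \<subseteq> j ` ?F"
    using A by (intro L.generate_field_min_subfield1 jF image_mono) (auto intro: generate_field.incl)
  then have alg: "(L.algebraic over (j ` ?F)) (j x)"
    using x(2) L.algebraic_mono by (auto simp: L.algebraic_span_def)
  have jx: "j x \<in> carrier L" using x(1) by simp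
  obtain n :: nat and f i0 where f: "f \<in> {..<n} \<rightarrow> j ` ?F"
     and sum0: "(\<Oplus>\<^bsub>L\<^esub>i\<in>{..<n}. f i \<otimes>\<^bsub>L\<^esub> j x [^]\<^bsub>L\<^esub> i) = \<zero>\<^bsub>L\<^esub>" and i0: "i0 < n" "f i0 \<noteq> \<zero>\<^bsub>L\<^esub>"
    by (rule L.power_sum_of_algebraic[OF subfieldE(1)[OF jF] jx alg])
  have "\<forall>i\<in>{..<n}. \<exists>c\<in>?F. f i = j c" using f by auto
  then obtain c where c: "\<And>i. i \<in> {..<n} \<Longrightarrow> c i \<in> ?F \<and> f i = j (c i)" by metis
  have cc: "c i \<in> carrier K" if "i < n" for i using c[of i] that FE(1) by auto
  have "j (\<Oplus>\<^bsub>K\<^esub>i\<in>{..<n}. c i \<otimes>\<^bsub>K\<^esub> x [^]\<^bsub>K\<^esub> i) = (\<Oplus>\<^bsub>L\<^esub>i\<in>{..<n}. j (c i \<otimes>\<^bsub>K\<^esub> x [^]\<^bsub>K\<^esub> i))"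
    using cc x by (subst jc.hom_finsum) (auto simp: comp_def)
  also have "\<dots> = (\<Oplus>\<^bsub>L\<^esub>i\<in>{..<n}. f i \<otimes>\<^bsub>L\<^esub> j x [^]\<^bsub>L\<^esub> i)"
    using cc c x by (intro L.finsum_cong') (auto simp: j.hom_nat_pow)
  finally have eq: "j (\<Oplus>\<^bsub>K\<^esub>i\<in>{..<n}. c i \<otimes>\<^bsub>K\<^esub> x [^]\<^bsub>K\<^esub> i) = j \<zero>\<^bsub>K\<^esub>" using sum0 by simp
  have "(\<Oplus>\<^bsub>K\<^esub>i\<in>{..<n}. c i \<otimes>\<^bsub>K\<^esub> x [^]\<^bsub>K\<^esub> i) \<in> carrier K"
    using cc x by (intro K.finsum_closed) auto
  then have "(\<Oplus>\<^bsub>K\<^esub>i\<in>{..<n}. c i \<otimes>\<^bsub>K\<^esub> x [^]\<^bsub>K\<^esub> i) = \<zero>\<^bsub>K\<^esub>"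
    using inj_onD[OF jinj eq] by simp
  moreover have "c i0 \<noteq> \<zero>\<^bsub>K\<^esub>" using c[of i0] i0 by auto
  ultimately have "(K.algebraic over ?F) x"
    using K.algebraic_of_power_sum[OF subfieldE(1)[OF F] x(1), of c n i0] c i0 by auto
  then show ?thesis using x(1) by (simp add: K.algebraic_span_def)
qed

lemma ex_extension_with_independent_elements:
  fixes k :: "('a, 'm) ring_scheme" and d :: nat
  assumes k: "field k" and inf: "infinite (UNIV :: 'b set)" and small: "carrier k \<lesssim> (UNIV :: 'b set)"
  shows "\<exists>(K :: 'b ring) \<iota> a. field_extension k K \<iota> \<and>
    (\<forall>i<d. a i \<in> carrier K \<and> a i \<notin> field.algebraic_span K (\<iota> ` carrier k \<union> a ` {..<i}))"
proof (induction d)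
  case 0
  then show ?case
    using field.ex_transcendental_extension[OF k inf small] k by (auto simp: field_extension_def)
next
  case (Suc d)
  then obtain K :: "'b ring" and \<iota> a where ext: "field_extension k K \<iota>"
    and a: "\<forall>i<d. a i \<in> carrier K \<and> a i \<notin> field.algebraic_span K (\<iota> ` carrier k \<union> a ` {..<i})"
    by blast
  have K: "field K" and \<iota>: "\<iota> \<in> Ring.ring_hom k K" using ext by (auto simp: field_extension_def)
  have "carrier K \<lesssim> (UNIV :: 'b set)" by (rule subset_imp_lepoll) simp
  then obtain L :: "'b ring" and j t where L: "field L" and j: "j \<in> Ring.ring_hom K L"
    and t: "t \<in> carrier L" "t \<notin> field.algebraic_span L (j ` carrier K)"
    using field.ex_transcendental_extension[OF K inf] by blast
  interpret L: field L by fact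
  define a' where "a' = (\<lambda>i. if i < d then j (a i) else t)"
  have \<iota>c: "\<iota> ` carrier k \<subseteq> carrier K" using ring_hom_closed[OF \<iota>] by auto
  have jc: "j ` carrier K \<subseteq> carrier L" using ring_hom_closed[OF j] by auto
  have img: "(j \<circ> \<iota>) ` carrier k \<union> a' ` {..<i} = j ` (\<iota> ` carrier k \<union> a ` {..<i})" if "i \<le> d" for i
    using that by (auto simp: a'_def image_Un image_image)
  have sub: "\<iota> ` carrier k \<union> a ` {..<i} \<subseteq> carrier K" if "i \<le> d" for i
    using that \<iota>c a by auto
  have "a' i \<in> carrier L \<and> a' i \<notin> L.algebraic_span ((j \<circ> \<iota>) ` carrier k \<union> a' ` {..<i})"
    if i: "i < Suc d" for i
  proof (cases "i = d")
    case True
    have "L.algebraic_span (j ` (\<iota> ` carrier k \<union> a ` {..<d})) \<subseteq> L.algebraic_span (j ` carrier K)"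
      using sub[of d] jc by (intro L.algebraic_span_mono image_mono) auto
    then show ?thesis using t True img[of d] by (auto simp: a'_def)
  next
    case False
    then have "i < d" using i by simp
    then show ?thesis
      using algebraic_span_hom_reflect[OF K L j sub[of i], of "a i"] a img[of i] jc
      by (auto simp: a'_def)
  qed
  then have "\<forall>i<Suc d. a' i \<in> carrier L \<and> a' i \<notin> L.algebraic_span ((j \<circ> \<iota>) ` carrier k \<union> a' ` {..<i})"
    by blast
  moreover have "field_extension k L (j \<circ> \<iota>)"
    using k L ring_hom_trans[OF \<iota> j] by (simp add: field_extension_def)
  ultimately show ?case
    by (intro exI) (rule conjI)
qed

section \<open>Induced matrix representations\<close>

text \<open>Requiring \<open>\<one>\<close> to represent the coset \<open>E\<close> makes the restriction to \<open>E\<close> of an induced representation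
contain the original one without conjugation.\<close>

lemma (in group) ex_left_transversal:
  assumes E: "subgroup E G"
  shows "\<exists>T \<subseteq> carrier G. \<one> \<in> T \<and> (\<forall>g\<in>carrier G. \<exists>!r. r \<in> T \<and> inv r \<otimes> g \<in> E)"
proof -
  interpret E: subgroup E G by fact
  have sym: "inv y \<otimes> x \<in> E" if "inv x \<otimes> y \<in> E" "x \<in> carrier G" "y \<in> carrier G" for x y
    using E.m_inv_closed[OF that(1)] that by (simp add: inv_mult_group)
  have trans: "inv x \<otimes> z \<in> E" if "inv x \<otimes> y \<in> E" "inv y \<otimes> z \<in> E" "x \<in> carrier G" "y \<in> carrier G" "z \<in> carrier G"
    for x y z
  proof -
    have "inv x \<otimes> y \<otimes> (inv y \<otimes> z) = inv x \<otimes> z"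
      using that by (simp add: m_assoc) (simp add: m_assoc[symmetric])
    then show ?thesis using E.m_closed[OF that(1,2)] by simp
  qed
  define C where "C = (\<lambda>g. {h \<in> carrier G. inv g \<otimes> h \<in> E})"
  have C_eq: "C g = C h" if "inv g \<otimes> h \<in> E" "g \<in> carrier G" "h \<in> carrier G" for g h
    using that trans sym unfolding C_def by blast
  have C_self: "g \<in> C g" if "g \<in> carrier G" for g using that by (simp add: C_def)
  (* the choice depends only on the coset C g, and is the unit on the trivial coset *)
  define r where "r = (\<lambda>g. if \<one> \<in> C g then \<one> else SOME h. h \<in> C g)"
  have rC: "r g \<in> C g" if "g \<in> carrier G" for g
    using C_self[OF that] by (auto simp: r_def intro: someI)
  have rc: "r g \<in> carrier G" "inv (r g) \<otimes> g \<in> E" if "g \<in> carrier G" for g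
    using rC[OF that] that sym[of g "r g"] by (auto simp: C_def)
  have r_eq: "r g = r h" if "inv g \<otimes> h \<in> E" "g \<in> carrier G" "h \<in> carrier G" for g h
    using C_eq[OF that] by (simp add: r_def)
  show ?thesis
  proof (intro exI[of _ "r ` carrier G"] conjI ballI)
    show "r ` carrier G \<subseteq> carrier G" using rc by auto
    have "r \<one> = \<one>" using C_self[of \<one>] by (simp add: r_def)
    then show "\<one> \<in> r ` carrier G" by (metis image_eqI one_closed)
    fix g assume g: "g \<in> carrier G"
    show "\<exists>!x. x \<in> r ` carrier G \<and> inv x \<otimes> g \<in> E"
    proof (rule ex1I[of _ "r g"])
      show "r g \<in> r ` carrier G \<and> inv (r g) \<otimes> g \<in> E" using rc g by auto
      fix x assume "x \<in> r ` carrier G \<and> inv x \<otimes> g \<in> E"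
      then obtain h where h: "h \<in> carrier G" "x = r h" "inv (r h) \<otimes> g \<in> E" by auto
      have "inv h \<otimes> r h \<in> E" using rC[OF h(1)] by (simp add: C_def)
      then have "inv h \<otimes> g \<in> E" using trans[of h "r h" g] h g rc by auto
      then show "x = r g" using r_eq h g by simp
    qed
  qed
qed

text \<open>For a left transversal \<open>T\<close> of \<open>E\<close> in \<open>G\<close> and a matrix representation \<open>\<tau>\<close> of \<open>E\<close> with index set \<open>J\<close>,
these are the entries of the induced representation in the basis indexed by \<open>T \<times> J\<close>.\<close>

definition (in ring) induced_entry ::
  "('g, 'm) monoid_scheme \<Rightarrow> 'g set \<Rightarrow> ('g \<Rightarrow> 'i \<Rightarrow> 'i \<Rightarrow> 'a) \<Rightarrow> 'g \<Rightarrow> 'g \<times> 'i \<Rightarrow> 'g \<times> 'i \<Rightarrow> 'a"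
  where "induced_entry G E \<tau> g z w =
    (let e = inv\<^bsub>G\<^esub> fst z \<otimes>\<^bsub>G\<^esub> g \<otimes>\<^bsub>G\<^esub> fst w in if e \<in> E then \<tau> e (snd z) (snd w) else \<zero>)"

text \<open>For a given \<open>y\<close> in \<open>T\<close> exactly one \<open>r\<close> in \<open>T\<close> has \<open>r\<^sup>-\<^sup>1 h y\<close> in \<open>E\<close>, so only one block contributes to
the matrix product, and there \<open>(x\<^sup>-\<^sup>1 g r) (r\<^sup>-\<^sup>1 h y) = x\<^sup>-\<^sup>1 g h y\<close>.\<close>

lemma (in ring) induced_entry_mult:
  fixes G :: "('g, 'm) monoid_scheme" and J :: "'i set"
  assumes G: "group G" and E: "subgroup E G"
    and T: "finite T" "T \<subseteq> carrier G" "\<forall>g\<in>carrier G. \<exists>!r. r \<in> T \<and> inv\<^bsub>G\<^esub> r \<otimes>\<^bsub>G\<^esub> g \<in> E"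
    and J: "finite J" and \<tau>c: "\<And>e i j. e \<in> E \<Longrightarrow> i \<in> J \<Longrightarrow> j \<in> J \<Longrightarrow> \<tau> e i j \<in> carrier R"
    and \<tau>m: "\<And>e f i j. e \<in> E \<Longrightarrow> f \<in> E \<Longrightarrow> i \<in> J \<Longrightarrow> j \<in> J \<Longrightarrow>
      \<tau> (e \<otimes>\<^bsub>G\<^esub> f) i j = (\<Oplus>l\<in>J. \<tau> e i l \<otimes> \<tau> f l j)"
    and g: "g \<in> carrier G" and h: "h \<in> carrier G" and z: "z \<in> T \<times> J" and w: "w \<in> T \<times> J"
  shows "induced_entry G E \<tau> (g \<otimes>\<^bsub>G\<^esub> h) z w
     = (\<Oplus>v\<in>T \<times> J. induced_entry G E \<tau> g z v \<otimes> induced_entry G E \<tau> h v w)"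
proof -
  interpret G: group G by fact
  interpret E: subgroup E G by fact
  obtain x i where x: "z = (x, i)" "x \<in> T" "i \<in> J" using z by auto
  obtain y j where y: "w = (y, j)" "y \<in> T" "j \<in> J" using w by auto
  have xy: "x \<in> carrier G" "y \<in> carrier G" using x y T by auto
  have "\<exists>!r. r \<in> T \<and> inv\<^bsub>G\<^esub> r \<otimes>\<^bsub>G\<^esub> (h \<otimes>\<^bsub>G\<^esub> y) \<in> E" using T(3) h xy by simp
  then obtain r where r: "r \<in> T" "inv\<^bsub>G\<^esub> r \<otimes>\<^bsub>G\<^esub> (h \<otimes>\<^bsub>G\<^esub> y) \<in> E"
    and uniq: "\<And>s. s \<in> T \<Longrightarrow> inv\<^bsub>G\<^esub> s \<otimes>\<^bsub>G\<^esub> (h \<otimes>\<^bsub>G\<^esub> y) \<in> E \<Longrightarrow> s = r" by blast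
  have rc: "r \<in> carrier G" using r T by auto
  define f where "f = inv\<^bsub>G\<^esub> r \<otimes>\<^bsub>G\<^esub> h \<otimes>\<^bsub>G\<^esub> y"
  define e where "e = inv\<^bsub>G\<^esub> x \<otimes>\<^bsub>G\<^esub> g \<otimes>\<^bsub>G\<^esub> r"
  have f: "f \<in> E" using r rc h xy by (simp add: f_def G.m_assoc)
  have ec: "e \<in> carrier G" and fc: "f \<in> carrier G" using xy rc g h by (auto simp: e_def f_def)
  have ef: "inv\<^bsub>G\<^esub> x \<otimes>\<^bsub>G\<^esub> (g \<otimes>\<^bsub>G\<^esub> h) \<otimes>\<^bsub>G\<^esub> y = e \<otimes>\<^bsub>G\<^esub> f"
  proof -
    have "r \<otimes>\<^bsub>G\<^esub> (inv\<^bsub>G\<^esub> r \<otimes>\<^bsub>G\<^esub> (h \<otimes>\<^bsub>G\<^esub> y)) = h \<otimes>\<^bsub>G\<^esub> y"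
      using rc h xy by (simp add: G.m_assoc[symmetric])
    then show ?thesis using xy rc g h by (simp add: e_def f_def G.m_assoc)
  qed
  have efE: "e \<otimes>\<^bsub>G\<^esub> f \<in> E \<longleftrightarrow> e \<in> E"
  proof
    assume "e \<otimes>\<^bsub>G\<^esub> f \<in> E"
    then have "e \<otimes>\<^bsub>G\<^esub> f \<otimes>\<^bsub>G\<^esub> inv\<^bsub>G\<^esub> f \<in> E" using f by auto
    then show "e \<in> E" using ec fc by (simp add: G.m_assoc)
  qed (use f in auto)
  have off: "induced_entry G E \<tau> h v w = \<zero>" if "v \<in> T \<times> J" "fst v \<noteq> r" for v
  proof -
    obtain s l where sl: "v = (s, l)" by (cases v)
    have v: "v = (s, l)" "s \<in> T" "s \<noteq> r" using that sl by auto
    have "inv\<^bsub>G\<^esub> s \<otimes>\<^bsub>G\<^esub> h \<otimes>\<^bsub>G\<^esub> y \<notin> E"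
      using uniq[OF v(2)] v T(2) h xy by (auto simp: G.m_assoc)
    then show ?thesis by (simp add: induced_entry_def v y)
  qed
  have gc: "induced_entry G E \<tau> g' v v' \<in> carrier R" if "v \<in> T \<times> J" "v' \<in> T \<times> J" for g' v v'
    using that \<tau>c by (auto simp: induced_entry_def Let_def)
  have "(\<Oplus>v\<in>T \<times> J. induced_entry G E \<tau> g z v \<otimes> induced_entry G E \<tau> h v w)
      = (\<Oplus>v\<in>Pair r ` J. induced_entry G E \<tau> g z v \<otimes> induced_entry G E \<tau> h v w)"
    using T J r off gc z w by (intro add.finprod_mono_neutral_cong_right) (auto simp: image_iff)
  also have "\<dots> = (\<Oplus>l\<in>J. induced_entry G E \<tau> g z (r, l) \<otimes> induced_entry G E \<tau> h (r, l) w)"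
    using gc z w r by (intro finsum_reindex) (auto simp: inj_on_def)
  also have "\<dots> = (\<Oplus>l\<in>J. (if e \<in> E then \<tau> e i l else \<zero>) \<otimes> \<tau> f l j)"
    using f x y \<tau>c by (intro finsum_cong') (auto simp: induced_entry_def e_def f_def)
  also have "\<dots> = (if e \<in> E then \<tau> (e \<otimes>\<^bsub>G\<^esub> f) i j else \<zero>)"
  proof (cases "e \<in> E")
    case True
    then show ?thesis using \<tau>m[OF True f x(3) y(3)] by simp
  next
    case False
    then show ?thesis using \<tau>c f y by (auto intro!: add.finprod_one_eqI)
  qed
  also have "\<dots> = induced_entry G E \<tau> (g \<otimes>\<^bsub>G\<^esub> h) z w"
    using efE by (simp add: induced_entry_def x y ef)
  finally show ?thesis ..
qed

lemma (in ring) induced_entry_one: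
  fixes G :: "('g, 'm) monoid_scheme"
  assumes G: "group G" and E: "subgroup E G"
    and T: "T \<subseteq> carrier G" "\<forall>g\<in>carrier G. \<exists>!r. r \<in> T \<and> inv\<^bsub>G\<^esub> r \<otimes>\<^bsub>G\<^esub> g \<in> E"
    and \<tau>1: "\<And>i j. i \<in> J \<Longrightarrow> j \<in> J \<Longrightarrow> \<tau> \<one>\<^bsub>G\<^esub> i j = (if i = j then \<one> else \<zero>)"
    and z: "z \<in> T \<times> J" and w: "w \<in> T \<times> J"
  shows "induced_entry G E \<tau> \<one>\<^bsub>G\<^esub> z w = (if z = w then \<one> else \<zero>)"
proof -
  interpret G: group G by fact
  interpret E: subgroup E G by fact
  obtain x i where x: "z = (x, i)" "x \<in> T" "i \<in> J" using z by auto
  obtain y j where y: "w = (y, j)" "y \<in> T" "j \<in> J" using w by auto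
  have xy: "x \<in> carrier G" "y \<in> carrier G" using x y T by auto
  have "x = y" if "inv\<^bsub>G\<^esub> x \<otimes>\<^bsub>G\<^esub> y \<in> E"
    using T(2)[rule_format, OF xy(2)] x(2) y(2) that xy by auto
  then show ?thesis using x y xy \<tau>1 by (auto simp: induced_entry_def Let_def)
qed

lemma (in ring) matrix_rep_hom:
  fixes G :: "('g, 'm) monoid_scheme" and I :: "'i set"
  assumes G: "group G" and idx: "bij_betw idx {..<N} I"
    and c: "\<And>g z w. g \<in> carrier G \<Longrightarrow> z \<in> I \<Longrightarrow> w \<in> I \<Longrightarrow> r g z w \<in> carrier R"
    and m: "\<And>g h z w. g \<in> carrier G \<Longrightarrow> h \<in> carrier G \<Longrightarrow> z \<in> I \<Longrightarrow> w \<in> I \<Longrightarrow>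
      r (g \<otimes>\<^bsub>G\<^esub> h) z w = (\<Oplus>v\<in>I. r g z v \<otimes> r h v w)"
    and one: "\<And>z w. z \<in> I \<Longrightarrow> w \<in> I \<Longrightarrow> r \<one>\<^bsub>G\<^esub> z w = (if z = w then \<one> else \<zero>)"
  shows "(\<lambda>g. mat N N (\<lambda>(i, j). r g (idx i) (idx j))) \<in> hom G (GL N R)"
proof -
  interpret G: group G by fact
  let ?M = "square_matrices N R"
  let ?\<rho> = "\<lambda>g. mat N N (\<lambda>(i, j). r g (idx i) (idx j))"
  have I: "idx i \<in> I" if "i < N" for i using idx that by (auto simp: bij_betw_def)
  have inj: "inj_on idx {..<N}" "idx ` {..<N} = I" using idx by (auto simp: bij_betw_def)
  have car: "?\<rho> g \<in> carrier ?M" if "g \<in> carrier G" for g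
    using c I that by (auto simp: square_matrices_carrier_iff)
  have mult: "?\<rho> (g \<otimes>\<^bsub>G\<^esub> h) = ?\<rho> g \<otimes>\<^bsub>?M\<^esub> ?\<rho> h" if gh: "g \<in> carrier G" "h \<in> carrier G" for g h
  proof (rule eq_matI)
    show "dim_row (?\<rho> (g \<otimes>\<^bsub>G\<^esub> h)) = dim_row (?\<rho> g \<otimes>\<^bsub>?M\<^esub> ?\<rho> h)"
      "dim_col (?\<rho> (g \<otimes>\<^bsub>G\<^esub> h)) = dim_col (?\<rho> g \<otimes>\<^bsub>?M\<^esub> ?\<rho> h)"
      by (simp_all add: square_matrices_def)
    fix i j assume "i < dim_row (?\<rho> g \<otimes>\<^bsub>?M\<^esub> ?\<rho> h)" "j < dim_col (?\<rho> g \<otimes>\<^bsub>?M\<^esub> ?\<rho> h)"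
    then have ij: "i < N" "j < N" by (simp_all add: square_matrices_def)
    have "r (g \<otimes>\<^bsub>G\<^esub> h) (idx i) (idx j) = (\<Oplus>v\<in>idx ` {..<N}. r g (idx i) v \<otimes> r h v (idx j))"
      using m gh I ij inj by simp
    also have "\<dots> = (\<Oplus>l\<in>{..<N}. r g (idx i) (idx l) \<otimes> r h (idx l) (idx j))"
      using c gh I ij inj by (intro finsum_reindex) auto
    also have "\<dots> = (\<Oplus>l\<in>{..<N}. ?\<rho> g $$ (i, l) \<otimes> ?\<rho> h $$ (l, j))"
      using c gh I ij by (intro finsum_cong') auto
    finally show "?\<rho> (g \<otimes>\<^bsub>G\<^esub> h) $$ (i, j) = (?\<rho> g \<otimes>\<^bsub>?M\<^esub> ?\<rho> h) $$ (i, j)"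
      using ij by (simp add: square_matrices_mult_index)
  qed
  have one': "?\<rho> \<one>\<^bsub>G\<^esub> = \<one>\<^bsub>?M\<^esub>"
    using one I inj by (intro eq_matI) (auto simp: square_matrices_def inj_on_def)
  have units: "?\<rho> g \<in> Units ?M" if g: "g \<in> carrier G" for g
  proof -
    have "?\<rho> (inv\<^bsub>G\<^esub> g) \<otimes>\<^bsub>?M\<^esub> ?\<rho> g = \<one>\<^bsub>?M\<^esub>" "?\<rho> g \<otimes>\<^bsub>?M\<^esub> ?\<rho> (inv\<^bsub>G\<^esub> g) = \<one>\<^bsub>?M\<^esub>"
      using mult[of "inv\<^bsub>G\<^esub> g" g] mult[of g "inv\<^bsub>G\<^esub> g"] one' g by simp_all
    then show ?thesis using car[OF g] car[of "inv\<^bsub>G\<^esub> g"] g unfolding Units_def by blast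
  qed
  show ?thesis
    by (rule homI) (use units mult in \<open>simp_all add: GL_def units_of_carrier units_of_mult\<close>)
qed

section \<open>Representations of large essential dimension\<close>

text \<open>The block diagonal matrix with one block \<open>(1 L(c); 0 1)\<close> for every \<open>c\<close>; within a block \<open>False\<close>
stands for the first and \<open>True\<close> for the second basis vector.\<close>

definition (in ring) transvection_entry :: "('c \<Rightarrow> 'a) \<Rightarrow> 'c \<times> bool \<Rightarrow> 'c \<times> bool \<Rightarrow> 'a" where
  "transvection_entry L i j =
    (if i = j then \<one> else if fst i = fst j \<and> \<not> snd i \<and> snd j then L (fst i) else \<zero>)"

lemma (in ring) transvection_entry_closed:
  assumes "\<And>c. c \<in> C \<Longrightarrow> L c \<in> carrier R" "i \<in> C \<times> UNIV"
  shows "transvection_entry L i j \<in> carrier R"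
  using assms by (auto simp: transvection_entry_def)

lemma (in ring) transvection_entry_mult:
  assumes C: "finite C" and L1: "\<And>c. c \<in> C \<Longrightarrow> L1 c \<in> carrier R"
    and L2: "\<And>c. c \<in> C \<Longrightarrow> L2 c \<in> carrier R" and L: "\<And>c. c \<in> C \<Longrightarrow> L c = L1 c \<oplus> L2 c"
    and ij: "i \<in> C \<times> UNIV" "j \<in> C \<times> UNIV"
  shows "transvection_entry L i j
    = (\<Oplus>l\<in>C \<times> UNIV. transvection_entry L1 i l \<otimes> transvection_entry L2 l j)"
proof -
  obtain c b where i: "i = (c, b)" "c \<in> C" using ij by auto
  obtain c' b' where j: "j = (c', b')" "c' \<in> C" using ij by auto
  have cl: "transvection_entry L1 i l \<in> carrier R" "transvection_entry L2 l j \<in> carrier R"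
    if "l \<in> C \<times> UNIV" for l
    using transvection_entry_closed[of C L1 i l] transvection_entry_closed[of C L2 l j] L1 L2 ij that
    by auto
  have "(\<Oplus>l\<in>C \<times> UNIV. transvection_entry L1 i l \<otimes> transvection_entry L2 l j)
    = transvection_entry L1 i (c, False) \<otimes> transvection_entry L2 (c, False) j
      \<oplus> transvection_entry L1 i (c, True) \<otimes> transvection_entry L2 (c, True) j"
  proof (rule finsum_two)
    fix l assume l: "l \<in> C \<times> UNIV" "l \<noteq> (c, False)" "l \<noteq> (c, True)"
    obtain e s where es: "l = (e, s)" by (cases l)
    then have "e \<noteq> c" using l by (cases s) auto
    then have "transvection_entry L1 i l = \<zero>" by (auto simp: transvection_entry_def i es)
    then show "transvection_entry L1 i l \<otimes> transvection_entry L2 l j = \<zero>" using cl[OF l(1)] by simp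
  qed (use C i cl in auto)
  also have "\<dots> = transvection_entry L i j"
    using i j L1[OF i(2)] L2[OF i(2)] L[OF i(2)]
    by (cases b; cases b'; cases "c = c'") (auto simp: transvection_entry_def a_comm)
  finally show ?thesis ..
qed

text \<open>In characteristic \<open>p\<close> residues modulo \<open>p\<close> act on the ring, which is what makes \<open>\<int>/p\<close> map
additively into it.\<close>

lemma (in ring) add_pow_one_mod:
  fixes p n :: nat
  assumes "add_pow R p \<one> = \<zero>"
  shows "add_pow R (n mod p) \<one> = add_pow R n \<one>"
proof -
  have "add_pow R n \<one> = add_pow R (p * (n div p) + n mod p) \<one>" by simp
  also have "\<dots> = add_pow R (p * (n div p)) \<one> \<oplus> add_pow R (n mod p) \<one>"
    by (rule add.nat_pow_mult[symmetric]) simp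
  also have "add_pow R (p * (n div p)) \<one> = add_pow R (n div p) (add_pow R p \<one>)"
    by (rule add.nat_pow_pow[symmetric]) simp
  also have "\<dots> = \<zero>" by (simp add: assms)
  finally show ?thesis by simp
qed

lemma field_extension_char:
  assumes "field_extension k K \<iota>" "has_characteristic k p"
  shows "add_pow K p \<one>\<^bsub>K\<^esub> = \<zero>\<^bsub>K\<^esub>"
proof -
  interpret k: field k using assms by (simp add: field_extension_def)
  interpret K: field K using assms by (simp add: field_extension_def)
  interpret i: ring_hom_ring k K \<iota>
    using assms by (intro ring_hom_ringI2) (auto simp: field_extension_def k.ring_axioms K.ring_axioms)
  have hom: "\<iota> (add_pow k n \<one>\<^bsub>k\<^esub>) = add_pow K n \<one>\<^bsub>K\<^esub>" for n :: nat
    by (induction n) simp_all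
  have "add_pow k p \<one>\<^bsub>k\<^esub> = \<zero>\<^bsub>k\<^esub>"
    using assms(2)[unfolded has_characteristic_def, rule_format, of p] by simp
  then show ?thesis using hom[of p] by simp
qed

text \<open>Let \<open>\<phi>\<close> identify \<open>E\<close> with \<open>(\<int>/p)\<^sup>2\<close>. For every \<open>c < d\<close> the map \<open>e \<mapsto> \<phi>\<^sub>1(e) + a c \<cdot> \<phi>\<^sub>2(e)\<close> is a
homomorphism from \<open>E\<close> to the additive group of the field, hence defines a two-dimensional unipotent
representation. The representation induced from the direct sum of these has the rows and columns
required by \<open>ed_rep_ge\<close>, at the positions that belong to the trivial coset.\<close>

lemma (in field) ex_rep_with_large_ed:
  fixes G :: "('g, 'm) monoid_scheme" and d p :: nat
  assumes p1: "p > 1" and char: "add_pow R p \<one> = \<zero>"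
    and G: "group G" "finite (carrier G)" and E: "subgroup E G"
    and iso: "G\<lparr>carrier := E\<rparr> \<cong> integer_mod_group p \<times>\<times> integer_mod_group p"
    and F: "subring F R"
    and a: "\<And>i. i < d \<Longrightarrow> a i \<in> carrier R" "\<And>i. i < d \<Longrightarrow> a i \<notin> algebraic_span (F \<union> a ` {..<i})"
    and d: "d > 0"
  shows "\<exists>N \<rho>. N \<ge> 1 \<and> \<rho> \<in> hom G (GL N R) \<and> enat d \<le> ed_rep R F N G \<rho>"
proof -
  interpret G: group G by fact
  interpret E: subgroup E G by fact
  let ?Z = "integer_mod_group p"
  obtain \<phi> where \<phi>: "\<phi> \<in> hom (G\<lparr>carrier := E\<rparr>) (?Z \<times>\<times> ?Z)" and bij: "bij_betw \<phi> E (carrier (?Z \<times>\<times> ?Z))"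
    using iso by (auto simp: is_iso_def iso_def)
  have Zc: "carrier (?Z \<times>\<times> ?Z) = {0..<int p} \<times> {0..<int p}"
    using p1 by (simp add: carrier_integer_mod_group)
  have \<phi>c: "fst (\<phi> e) \<in> {0..<int p}" "snd (\<phi> e) \<in> {0..<int p}" if "e \<in> E" for e
    using bij_betwE[OF bij] that unfolding Zc by (auto simp: mem_Times_iff)
  have \<phi>m: "\<phi> (e \<otimes>\<^bsub>G\<^esub> f) = ((fst (\<phi> e) + fst (\<phi> f)) mod int p, (snd (\<phi> e) + snd (\<phi> f)) mod int p)"
    if "e \<in> E" "f \<in> E" for e f
    using hom_mult[OF \<phi>, of e f] that by (simp add: DirProd_def split_beta)
  define \<kappa> where "\<kappa> = (\<lambda>x::int. add_pow R (nat x) \<one>)"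
  have \<kappa>c: "\<kappa> x \<in> carrier R" for x by (simp add: \<kappa>_def)
  have \<kappa>add: "\<kappa> ((x + y) mod int p) = \<kappa> x \<oplus> \<kappa> y" if "x \<in> {0..<int p}" "y \<in> {0..<int p}" for x y
  proof -
    have "nat ((x + y) mod int p) = (nat x + nat y) mod p"
      using that by (simp add: nat_mod_distrib nat_add_distrib)
    then show ?thesis
      using add_pow_one_mod[OF char] by (simp add: \<kappa>_def add.nat_pow_mult)
  qed
  define L where "L = (\<lambda>e c. \<kappa> (fst (\<phi> e)) \<oplus> a c \<otimes> \<kappa> (snd (\<phi> e)))"
  have Lc: "L e c \<in> carrier R" if "c \<in> {..<d}" for e c using that a(1) \<kappa>c by (simp add: L_def)
  have Lm: "L (e \<otimes>\<^bsub>G\<^esub> f) c = L e c \<oplus> L f c" if e: "e \<in> E" and f: "f \<in> E" and c: "c \<in> {..<d}" for e f c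
  proof -
    have "L (e \<otimes>\<^bsub>G\<^esub> f) c = \<kappa> (fst (\<phi> e)) \<oplus> \<kappa> (fst (\<phi> f)) \<oplus> a c \<otimes> (\<kappa> (snd (\<phi> e)) \<oplus> \<kappa> (snd (\<phi> f)))"
      using \<phi>m[OF e f] \<kappa>add \<phi>c[OF e] \<phi>c[OF f] by (simp add: L_def)
    then show ?thesis
      using a(1)[of c] c \<kappa>c by (simp add: L_def r_distr a_ac)
  qed
  have L1: "L \<one>\<^bsub>G\<^esub> c = \<zero>" if "c \<in> {..<d}" for c
    using Lm[of "\<one>\<^bsub>G\<^esub>" "\<one>\<^bsub>G\<^esub>" c] that Lc[OF that, of "\<one>\<^bsub>G\<^esub>"] by simp
  define \<tau> where "\<tau> = (\<lambda>e. transvection_entry (L e))"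
  let ?J = "{..<d} \<times> (UNIV :: bool set)"
  have \<tau>c: "\<tau> e i j \<in> carrier R" if "i \<in> ?J" for e i j
    unfolding \<tau>_def using transvection_entry_closed[of "{..<d}" "L e" i j] Lc that by auto
  have \<tau>m: "\<tau> (e \<otimes>\<^bsub>G\<^esub> f) i j = (\<Oplus>l\<in>?J. \<tau> e i l \<otimes> \<tau> f l j)"
    if "e \<in> E" "f \<in> E" "i \<in> ?J" "j \<in> ?J" for e f i j
    unfolding \<tau>_def using that Lc Lm by (intro transvection_entry_mult) auto
  have \<tau>1: "\<tau> \<one>\<^bsub>G\<^esub> i j = (if i = j then \<one> else \<zero>)" if "i \<in> ?J" "j \<in> ?J" for i j
    using that L1 by (auto simp: \<tau>_def transvection_entry_def)
  obtain T where T: "T \<subseteq> carrier G" "\<one>\<^bsub>G\<^esub> \<in> T"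
      "\<forall>g\<in>carrier G. \<exists>!r. r \<in> T \<and> inv\<^bsub>G\<^esub> r \<otimes>\<^bsub>G\<^esub> g \<in> E"
    using G.ex_left_transversal[OF E] by blast
  have finT: "finite T" using T(1) G(2) by (rule finite_subset)
  let ?I = "T \<times> ?J"
  define N where "N = card ?I"
  have finI: "finite ?I" using finT by simp
  obtain idx where "bij_betw idx {0..<N} ?I"
    using ex_bij_betw_nat_finite[OF finI] unfolding N_def by blast
  then have idx: "bij_betw idx {..<N} ?I" by (simp add: atLeast0LessThan)
  let ?r = "induced_entry G E \<tau>"
  define \<rho> where "\<rho> = (\<lambda>g. mat N N (\<lambda>(i, j). ?r g (idx i) (idx j)))"
  have \<rho>: "\<rho> \<in> hom G (GL N R)"
    unfolding \<rho>_def
  proof (rule matrix_rep_hom[OF G(1) idx])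
    show "?r g z w \<in> carrier R" if "z \<in> ?I" "w \<in> ?I" for g z w
      using that \<tau>c by (auto simp: induced_entry_def Let_def)
    show "?r (g \<otimes>\<^bsub>G\<^esub> h) z w = (\<Oplus>v\<in>?I. ?r g z v \<otimes> ?r h v w)"
      if "g \<in> carrier G" "h \<in> carrier G" "z \<in> ?I" "w \<in> ?I" for g h z w
      using that \<tau>c \<tau>m by (intro induced_entry_mult[OF G(1) E finT T(1,3)]) auto
    show "?r \<one>\<^bsub>G\<^esub> z w = (if z = w then \<one> else \<zero>)" if "z \<in> ?I" "w \<in> ?I" for z w
      using that \<tau>1 by (intro induced_entry_one[OF G(1) E T(1,3)]) auto
  qed
  have N: "N \<ge> 1" using finI T(2) d unfolding N_def by (auto simp: Suc_le_eq card_gt_0_iff)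
  have uniqT: "y = \<one>\<^bsub>G\<^esub>" if "y \<in> T" "y \<in> E" for y
  proof -
    have "inv\<^bsub>G\<^esub> y \<otimes>\<^bsub>G\<^esub> y \<in> E" "inv\<^bsub>G\<^esub> \<one>\<^bsub>G\<^esub> \<otimes>\<^bsub>G\<^esub> y \<in> E" using that T(1) by auto
    moreover have "\<exists>!r. r \<in> T \<and> inv\<^bsub>G\<^esub> r \<otimes>\<^bsub>G\<^esub> y \<in> E" using T(1,3) that by auto
    ultimately show ?thesis using T(2) that(1) by (elim ex1E) metis
  qed
  have row: "?r e (\<one>\<^bsub>G\<^esub>, (c, False)) z
      = (if z = (\<one>\<^bsub>G\<^esub>, (c, False)) then \<one> else if z = (\<one>\<^bsub>G\<^esub>, (c, True)) then L e c else \<zero>)"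
    if e: "e \<in> E" and c: "c < d" and z: "z \<in> ?I" for e c z
  proof -
    obtain y j where y: "z = (y, j)" "y \<in> T" "j \<in> ?J" using z by auto
    have yc: "y \<in> carrier G" using y T by auto
    have "e \<otimes>\<^bsub>G\<^esub> y \<in> E \<longleftrightarrow> y \<in> E"
    proof
      assume "e \<otimes>\<^bsub>G\<^esub> y \<in> E"
      then have "inv\<^bsub>G\<^esub> e \<otimes>\<^bsub>G\<^esub> (e \<otimes>\<^bsub>G\<^esub> y) \<in> E" using e by auto
      then show "y \<in> E" using e yc by (simp add: G.m_assoc[symmetric])
    qed (use e in auto)
    then have "e \<otimes>\<^bsub>G\<^esub> y \<in> E \<longleftrightarrow> y = \<one>\<^bsub>G\<^esub>" using uniqT[OF y(2)] by auto
    then show ?thesis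
      using e yc y by (cases j) (auto simp: induced_entry_def \<tau>_def transvection_entry_def)
  qed
  have col: "?r e z (\<one>\<^bsub>G\<^esub>, (c, True))
      = (if z = (\<one>\<^bsub>G\<^esub>, (c, True)) then \<one> else if z = (\<one>\<^bsub>G\<^esub>, (c, False)) then L e c else \<zero>)"
    if e: "e \<in> E" and c: "c < d" and z: "z \<in> ?I" for e c z
  proof -
    obtain x j where x: "z = (x, j)" "x \<in> T" "j \<in> ?J" using z by auto
    have xc: "x \<in> carrier G" using x T by auto
    have "inv\<^bsub>G\<^esub> x \<otimes>\<^bsub>G\<^esub> e \<in> E \<longleftrightarrow> x \<in> E"
    proof
      assume "inv\<^bsub>G\<^esub> x \<otimes>\<^bsub>G\<^esub> e \<in> E"
      then have "e \<otimes>\<^bsub>G\<^esub> inv\<^bsub>G\<^esub> (inv\<^bsub>G\<^esub> x \<otimes>\<^bsub>G\<^esub> e) \<in> E" using e by auto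
      then show "x \<in> E" using e xc by (simp add: G.inv_mult_group G.m_assoc[symmetric])
    qed (use e in auto)
    then have "inv\<^bsub>G\<^esub> x \<otimes>\<^bsub>G\<^esub> e \<in> E \<longleftrightarrow> x = \<one>\<^bsub>G\<^esub>" using uniqT[OF x(2)] by auto
    then show ?thesis
      using e xc x by (cases j) (auto simp: induced_entry_def \<tau>_def transvection_entry_def)
  qed
  define pos where "pos = the_inv_into {..<N} idx"
  have pos: "pos z < N" "idx (pos z) = z" if "z \<in> ?I" for z
    using idx that the_inv_into_into[of idx "{..<N}" z "{..<N}"] f_the_inv_into_f[of idx "{..<N}" z]
    by (auto simp: pos_def bij_betw_def)
  have pos_iff: "j = pos z \<longleftrightarrow> idx j = z" if "j < N" "z \<in> ?I" for j z
    using that pos[OF that(2)] idx by (auto simp: bij_betw_def inj_on_def)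
  have idxI: "idx j \<in> ?I" if "j < N" for j using idx that by (auto simp: bij_betw_def)
  let ?p = "\<lambda>c. pos (\<one>\<^bsub>G\<^esub>, (c, False))" and ?q = "\<lambda>c. pos (\<one>\<^bsub>G\<^esub>, (c, True))"
  have inI: "(\<one>\<^bsub>G\<^esub>, (c, b)) \<in> ?I" if "c < d" for c b using that T(2) by auto
  have rowN: "\<rho> e $$ (?p c, j) = (if j = ?p c then \<one> else if j = ?q c then L e c else \<zero>)"
   and colN: "\<rho> e $$ (j, ?q c) = (if j = ?q c then \<one> else if j = ?p c then L e c else \<zero>)"
    if "e \<in> E" "c < d" "j < N" for e c j
    using row[OF that(1,2) idxI[OF that(3)]] col[OF that(1,2) idxI[OF that(3)]]
      pos[OF inI[OF that(2)]] pos_iff[OF that(3) inI[OF that(2)]] that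
    by (simp_all add: \<rho>_def)
  have surj: "\<exists>e\<in>E. \<phi> e = z" if "z \<in> {0..<int p} \<times> {0..<int p}" for z
    using bij that unfolding Zc bij_betw_def by (metis imageE)
  obtain h1 where h1: "h1 \<in> E" "\<phi> h1 = (1, 0)" using surj[of "(1, 0)"] p1 by auto
  obtain h2 where h2: "h2 \<in> E" "\<phi> h2 = (0, 1)" using surj[of "(0, 1)"] p1 by auto
  have \<kappa>01: "\<kappa> 0 = \<zero>" "\<kappa> 1 = \<one>" by (simp_all add: \<kappa>_def)
  have Lh: "L h1 c = \<one>" "L h2 c = a c" if "c < d" for c
    using a(1)[OF that] by (simp_all add: L_def h1 h2 \<kappa>01)
  have "enat d \<le> ed_rep R F N G \<rho>"
  proof (rule ed_rep_ge[where ?h1.0 = h1 and ?h2.0 = h2 and p = ?p and q = ?q and a = a, OF F \<rho>])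
    show "?p i < N \<and> ?q i < N \<and> ?p i \<noteq> ?q i" if "i < d" for i
      using pos[OF inI[OF that, of False]] pos[OF inI[OF that, of True]] by auto
  qed (use h1 h2 a rowN colN Lh in auto)
  then show ?thesis using N \<rho> by blast
qed

theorem proposition14p1:
  fixes p :: nat
    and k :: "('a, 'm) ring_scheme"
    and G :: "('g, 'n) monoid_scheme"
    and E :: "'g set" and g1 g2 :: 'g
  assumes "prime p"
    and "field k" and "has_characteristic k p"
    and "group G" and "finite (carrier G)"
    and "subgroup E G" and "E = generate G {g1, g2}"
    and "G\<lparr>carrier := E\<rparr> \<cong> integer_mod_group p \<times>\<times> integer_mod_group p"
    \<comment> \<open>the universe \<open>'b\<close> is large enough to contain copies of the function fields over \<open>k\<close>\<close>
    and "infinite (UNIV :: 'b set)" and "carrier k \<lesssim> (UNIV :: 'b set)"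
  shows "ed_Rep TYPE('b) G k = \<infinity>"
proof -
  have "enat d \<le> ed_Rep TYPE('b) G k" if d: "d > 0" for d
  proof -
    obtain K :: "'b ring" and \<iota> a where ext: "field_extension k K \<iota>"
      and a: "\<forall>i<d. a i \<in> carrier K \<and> a i \<notin> field.algebraic_span K (\<iota> ` carrier k \<union> a ` {..<i})"
      using ex_extension_with_independent_elements[OF assms(2,9,10)] by blast
    interpret k: field k by fact
    interpret K: field K using ext by (simp add: field_extension_def)
    interpret i: ring_hom_ring k K \<iota>
      using ext by (intro ring_hom_ringI2) (auto simp: field_extension_def k.ring_axioms K.ring_axioms)
    have "subring (\<iota> ` carrier k) K" by (rule i.img_is_subring[OF k.carrier_is_subring])
    then obtain N \<rho> where "N \<ge> 1" "\<rho> \<in> hom G (GL N K)" "enat d \<le> ed_rep K (\<iota> ` carrier k) N G \<rho>"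
      using K.ex_rep_with_large_ed[OF prime_gt_1_nat[OF assms(1)] field_extension_char[OF ext assms(3)] assms(4-6,8) _ _ _ d, of "\<iota> ` carrier k" a] a
      by blast
    moreover from this have "ed_rep K (\<iota> ` carrier k) N G \<rho> \<le> ed_Rep TYPE('b) G k"
      unfolding ed_Rep_def using ext by (intro Sup_upper) blast
    ultimately show ?thesis by (meson order_trans)
  qed
  then have "enat d < ed_Rep TYPE('b) G k" for d
    using less_le_trans[of "enat d" "enat (Suc d)"] by simp
  then show ?thesis by (metis enat_ord_simps(6) not_enat_eq order_less_irrefl)
qed

end
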